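(* Let $A\in\mathbb{R}^{n\times n}$ and $C=\mathrm{col}(C_1,\dots,C_N)$ with $C_i\in\mathbb{R}^{m_i\times n}$, and let $p_i:=\mathrm{rank}\,C_i$ for $i=1,\dots,N$. Assume that $(C,A)$ is observable and that $\mathcal{G}$ is a strongly connected weighted directed graph on the node set $\{1,\dots,N\}$ with adjacency matrix $[a_{ij}]$. Let $r=[r_1,\dots,r_N]$ be the unique positive row vector with $r\mathcal{L}=0$ and $r\mathbf{1}_N=N$, where $\mathcal{L}$ is the Laplacian of $\mathcal{G}$. Let $\alpha\ge 0$. Then there exist $\gamma\in\mathbb{R}$ and matrices $N_i\in\mathbb{R}^{(n-p_i)\times(n-p_i)}$, $L_i\in\mathbb{R}^{(n-p_i)\times m_i}$, $M_i\in\mathbb{R}^{(n-p_i)\times n}$, $P_i\in\mathbb{R}^{n\times(n-p_i)}$, $Q_i\in\mathbb{R}^{n\times m_i}$ ($i=1,\dots,N$) such that the distributed observer $$\dot z_i=N_iz_i+L_iy_i+\gamma r_iM_i\sum_{j=1}^N a_{ij}(\hat x_j-\hat x_i),\qquad \hat x_i=P_iz_i+Q_iy_i,\qquad i=1,\dots,N,$$ with $z_i(t)\in\mathbb{R}^{n-p_i}$ (so with total state space dimension $Nn-\sum_{i=1}^Np_i$), for the plant $\dot x=Ax$, $y_i=C_ix$, achieves omniscience asymptotically, and all error trajectories $e=\mathrm{col}(\hat x_1-x,\dots,\hat x_N-x)$ converge to zero with convergence rate at least $\alpha$.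
   Context: Graph conventions: $\mathcal{G}$ is a weighted directed graph with node set $\{1,\dots,N\}$ and adjacency matrix $\mathcal{A}=[a_{ij}]$, where $a_{ij}>0$ if there is an edge from $j$ to $i$ (information flows from $j$ to $i$) and $a_{ij}=0$ otherwise. $\mathcal{G}$ is strongly connected if for every pair of distinct nodes $i,j$ there is a directed path from $i$ to $j$. The Laplacian is $\mathcal{L}=\mathcal{D}-\mathcal{A}$, with $\mathcal{D}$ diagonal with entries $d_i=\sum_j a_{ij}$. $\mathbf{1}_N$ is the all-ones column vector in $\mathbb{R}^N$. For a strongly connected $\mathcal{G}$ there is a unique row vector $r$ with positive entries such that $r\mathcal{L}=0$ and $r\mathbf{1}_N=N$. $\mathrm{col}(\cdot)$ denotes vertical stacking. $(C,A)$ is observable if $\bigcap_{k=0}^{n-1}\ker CA^k=0$. The distributed observer achieves omniscience asymptotically if for every choice of initial states $x(0)$ and $z_1(0),\dots,z_N(0)$ one has $\lim_{t\to\infty}(\hat x_i(t)-x(t))=0$ for all $i$. Error trajectories converge to zero with convergence rate at least $\alpha$ if there is a constant $c>0$ such that $\|e(t)\|\le c\,e^{-\alpha t}\|e(0)\|$ for all $t\ge 0$ and all initial states. *)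

theory Defs
  imports
    Complex_Main
    "HOL-Analysis.L2_Norm"
    "Graph_Theory.Digraph_Component"
    "Jordan_Normal_Form.DL_Rank"
    "Jordan_Normal_Form.Matrix_Kernel"
begin

text \<open>
  Since the observer states live in spaces whose dimensions depend on the node, vectors and
  matrices are those of Jordan_Normal_Form, with explicit dimensions. Nodes and
  coordinates are numbered from 0, so the node set is \<open>{..<N}\<close>.
\<close>

definition stack_mat :: "nat \<Rightarrow> nat \<Rightarrow> (nat \<Rightarrow> real mat) \<Rightarrow> real mat" where
  "stack_mat n N C = mat_of_rows n (concat (map (\<lambda>i. rows (C i)) [0..<N]))"

definition stack_vec :: "nat \<Rightarrow> (nat \<Rightarrow> real Matrix.vec) \<Rightarrow> real Matrix.vec" where
  "stack_vec N v = vec_of_list (concat (map (\<lambda>i. list_of_vec (v i)) [0..<N]))"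

definition euclid_norm :: "real Matrix.vec \<Rightarrow> real" where
  "euclid_norm v = L2_set (\<lambda>k. v $ k) {..<dim_vec v}"

definition ones_vec :: "nat \<Rightarrow> real Matrix.vec" where
  "ones_vec N = Matrix.vec N (\<lambda>_. 1)"

text \<open>The intersection with \<open>carrier_vec n\<close> only matters for \<open>n = 0\<close>, where the index set is empty.\<close>

definition observable :: "nat \<Rightarrow> real mat \<Rightarrow> real mat \<Rightarrow> bool" where
  "observable n C A \<longleftrightarrow>
     carrier_vec n \<inter> (\<Inter>k\<in>{..<n}. mat_kernel (C * (A ^\<^sub>m k))) = {0\<^sub>v n}"

text \<open>
  A weighted directed graph is given by its adjacency matrix \<open>W\<close>; a positive entry
  \<open>W $$ (i, j)\<close> is the weight of an arc from \<open>j\<close> to \<open>i\<close>.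
\<close>

definition weighted_adjacency :: "nat \<Rightarrow> real mat \<Rightarrow> bool" where
  "weighted_adjacency N W \<longleftrightarrow>
     W \<in> carrier_mat N N \<and> (\<forall>i<N. \<forall>j<N. 0 \<le> W $$ (i, j))"

definition adjacency_digraph :: "nat \<Rightarrow> real mat \<Rightarrow> (nat, nat \<times> nat) pre_digraph" where
  "adjacency_digraph N W =
     \<lparr>verts = {..<N}, arcs = {(j, i). j < N \<and> i < N \<and> 0 < W $$ (i, j)}, tail = fst, head = snd\<rparr>"

definition laplacian :: "nat \<Rightarrow> real mat \<Rightarrow> real mat" where
  "laplacian N W = mat_diag N (\<lambda>i. \<Sum>j<N. W $$ (i, j)) - W"

text \<open>
  \<open>f' t\<close> is the derivative of \<open>f\<close> at every \<open>t \<ge> 0\<close>; it is one-sided at \<open>t = 0\<close>.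
\<close>

definition has_vec_derivative :: "nat \<Rightarrow> (real \<Rightarrow> real Matrix.vec) \<Rightarrow> (real \<Rightarrow> real Matrix.vec) \<Rightarrow> bool" where
  "has_vec_derivative d f f' \<longleftrightarrow>
     (\<forall>t\<ge>0. f t \<in> carrier_vec d \<and> f' t \<in> carrier_vec d \<and>
        (\<forall>k<d. ((\<lambda>s. f s $ k) has_real_derivative f' t $ k) (at t within {0..})))"

text \<open>
  In what follows, \<open>x\<close> is a plant trajectory and \<open>z i\<close> the state trajectory of the local
  observer at node \<open>i\<close>, of dimension \<open>q i\<close>. The measurement \<open>y i\<close> is \<open>C i *\<^sub>v x t\<close>.
\<close>

definition estimate ::
  "(nat \<Rightarrow> real mat) \<Rightarrow> (nat \<Rightarrow> real mat) \<Rightarrow> (nat \<Rightarrow> real mat) \<Rightarrow>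
   (real \<Rightarrow> real Matrix.vec) \<Rightarrow> (nat \<Rightarrow> real \<Rightarrow> real Matrix.vec) \<Rightarrow> nat \<Rightarrow> real \<Rightarrow> real Matrix.vec" where
  "estimate C P Q x z i t = P i *\<^sub>v z i t + Q i *\<^sub>v (C i *\<^sub>v x t)"

definition observer_trajectory ::
  "nat \<Rightarrow> nat \<Rightarrow> real mat \<Rightarrow> (nat \<Rightarrow> real mat) \<Rightarrow> real mat \<Rightarrow> real Matrix.vec \<Rightarrow> (nat \<Rightarrow> nat) \<Rightarrow>
   real \<Rightarrow> (nat \<Rightarrow> real mat) \<Rightarrow> (nat \<Rightarrow> real mat) \<Rightarrow> (nat \<Rightarrow> real mat) \<Rightarrow> (nat \<Rightarrow> real mat) \<Rightarrow>
   (nat \<Rightarrow> real mat) \<Rightarrow> (real \<Rightarrow> real Matrix.vec) \<Rightarrow> (nat \<Rightarrow> real \<Rightarrow> real Matrix.vec) \<Rightarrow> bool" where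
  "observer_trajectory n N A C W r q \<gamma> Nm L M P Q x z \<longleftrightarrow>
     has_vec_derivative n x (\<lambda>t. A *\<^sub>v x t) \<and>
     (\<forall>i<N. has_vec_derivative (q i) (z i)
        (\<lambda>t. Nm i *\<^sub>v z i t + L i *\<^sub>v (C i *\<^sub>v x t)
             + (\<gamma> * r $ i) \<cdot>\<^sub>v (M i *\<^sub>v
                 finsum_vec TYPE(real) n
                   (\<lambda>j. W $$ (i, j) \<cdot>\<^sub>v (estimate C P Q x z j t - estimate C P Q x z i t)) {..<N})))"

definition achieves_omniscience ::
  "nat \<Rightarrow> nat \<Rightarrow> real mat \<Rightarrow> (nat \<Rightarrow> real mat) \<Rightarrow> real mat \<Rightarrow> real Matrix.vec \<Rightarrow> (nat \<Rightarrow> nat) \<Rightarrow>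
   real \<Rightarrow> (nat \<Rightarrow> real mat) \<Rightarrow> (nat \<Rightarrow> real mat) \<Rightarrow> (nat \<Rightarrow> real mat) \<Rightarrow> (nat \<Rightarrow> real mat) \<Rightarrow>
   (nat \<Rightarrow> real mat) \<Rightarrow> bool" where
  "achieves_omniscience n N A C W r q \<gamma> Nm L M P Q \<longleftrightarrow>
     (\<forall>x z. observer_trajectory n N A C W r q \<gamma> Nm L M P Q x z \<longrightarrow>
        (\<forall>i<N. ((\<lambda>t. euclid_norm (estimate C P Q x z i t - x t)) \<longlongrightarrow> 0) at_top))"

definition observer_error ::
  "nat \<Rightarrow> (nat \<Rightarrow> real mat) \<Rightarrow> (nat \<Rightarrow> real mat) \<Rightarrow> (nat \<Rightarrow> real mat) \<Rightarrow>
   (real \<Rightarrow> real Matrix.vec) \<Rightarrow> (nat \<Rightarrow> real \<Rightarrow> real Matrix.vec) \<Rightarrow> real \<Rightarrow> real Matrix.vec" where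
  "observer_error N C P Q x z t = stack_vec N (\<lambda>i. estimate C P Q x z i t - x t)"

definition error_convergence_rate ::
  "nat \<Rightarrow> nat \<Rightarrow> real mat \<Rightarrow> (nat \<Rightarrow> real mat) \<Rightarrow> real mat \<Rightarrow> real Matrix.vec \<Rightarrow> (nat \<Rightarrow> nat) \<Rightarrow>
   real \<Rightarrow> (nat \<Rightarrow> real mat) \<Rightarrow> (nat \<Rightarrow> real mat) \<Rightarrow> (nat \<Rightarrow> real mat) \<Rightarrow> (nat \<Rightarrow> real mat) \<Rightarrow>
   (nat \<Rightarrow> real mat) \<Rightarrow> real \<Rightarrow> bool" where
  "error_convergence_rate n N A C W r q \<gamma> Nm L M P Q \<alpha> \<longleftrightarrow>
     (\<exists>c>0. \<forall>x z. observer_trajectory n N A C W r q \<gamma> Nm L M P Q x z \<longrightarrow>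
        (\<forall>t\<ge>0. euclid_norm (observer_error N C P Q x z t)
               \<le> c * exp (- \<alpha> * t) * euclid_norm (observer_error N C P Q x z 0)))"

end

(*
  Choose s large and put F = s I + A, D = inverse of F. The Gramian G of (C, D) is an inner product by
  observability, and F\<^sup>T G F \<le> G + C\<^sup>T C gives <v, A v> \<le> - sigma <v, v> + kappa |C v|^2 in this
  inner product, with sigma as large as desired.
  Node i measures C_i x and estimates only the component of x in ker C_i along its G-orthogonal
  complement. Its error e_i then stays in ker C_i and satisfies
  e_i' = Pi_i (A e_i + gamma r_i sum_j a_ij (e_j - e_i)), with Pi_i the G-orthogonal projection
  onto ker C_i. For V = sum_i <e_i, e_i> the projections drop out of V', and r L = 0 turns the
  coupling into - gamma sum_ij r_i a_ij |e_i - e_j|^2. The surplus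
  sum_i |C e_i|^2 = sum_ij |C_j (e_i - e_j)|^2 is dominated by that term because the graph is
  strongly connected, so a large gamma yields V' \<le> - 2 sigma V.
*)
theory Submission
  imports Defs "Jordan_Normal_Form.Char_Poly"
begin

text \<open>The obstacle is that node i sees only C_i x and (C_i, A) need not be observable, so a
  node may be unable to damp its own error and the coupling has to help. The estimate of V' survives
  the projections only if every Pi_i is orthogonal for one and the same inner product, the one in
  which A is dissipative up to the energy |C v|^2 of the full output. Hence the splitting at each
  node is built from the global Gramian and not from Euclidean geometry. The Gramian has a finite
  horizon: G_k is the sum over j = 1..k of (D^T)^j C^T C D^j. Then F^T G_{k+1} F = G_k + C^T C
  exactly, and G_k \<le> G_{k+1} turns this into the inequality for a single G_k. So neither
  convergence of powers of D nor a Lyapunov equation enters; s only has to be large with - s not an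
  eigenvalue of A. All constants are fixed before a trajectory is chosen: the gain is gamma = 2
  kappa K, where K compares the output energy with the disagreement of the errors.\<close>

section \<open>Kernels, inverses and crude bounds for quadratic forms\<close>

text \<open>This ties the observer order n - p_i to ker C_i. The rank is by definition the dimension
  of the column span, which is the range of the map v to A v, so rank-nullity for abstract linear
  maps applies.\<close>

lemma rank_plus_kernel_dim:
  fixes A :: "'a :: field mat"
  assumes A: "A \<in> carrier_mat m n"
  shows "vec_space.rank m A + kernel.dim n A = n"
proof -
  interpret K: kernel m n A by (unfold_locales, rule A)
  interpret M: vec_space "TYPE('a)" m .
  interpret T: linear_map class_ring "module_vec TYPE('a) n" "module_vec TYPE('a) m" "(*\<^sub>v) A"
  proof (intro linear_map.intro mod_hom.intro mod_hom_axioms.intro)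
    show "vectorspace class_ring (module_vec TYPE('a) n)" by (rule vec_vs)
    show "vectorspace class_ring (module_vec TYPE('a) m)" by (rule vec_vs)
    show "Module.module class_ring (module_vec TYPE('a) n)"
      by (rule vec_module)
    show "Module.module class_ring (module_vec TYPE('a) m)"
      by (rule vec_module)
    show "(*\<^sub>v) A \<in> module_hom class_ring (module_vec TYPE('a) n) (module_vec TYPE('a) m)"
      using A by (auto simp: module_hom_def module_vec_simps mult_add_distrib_mat_vec[OF A] mult_mat_vec[OF A])
  qed
  have im: "T.imT = M.span (set (cols A))"
    unfolding M.col_space_def[symmetric] M.col_space_eq[OF A] T.im_def
    using A by (auto simp: module_vec_simps simp del: mult_mat_vec_carrier intro: mult_mat_vec_carrier[OF A])
  have ker: "T.kerT = mat_kernel A"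
    using A unfolding T.ker_def by (auto simp: mat_kernel module_vec_simps)
  show ?thesis
    using T.rank_nullity[OF K.NC.fin_dim] K.NC.dim_is_n im ker
    unfolding M.rank_def by simp
qed

text \<open>The columns of \<open>P\<close> are a basis of the kernel; rank-nullity counts them. In
  the observer, \<open>P\<close> maps the local state into ker C_i.\<close>

lemma kernel_basis_matrix:
  fixes A :: "'a :: field mat"
  assumes A: "A \<in> carrier_mat m n"
  obtains P where "P \<in> carrier_mat n (n - vec_space.rank m A)"
    "\<And>u. u \<in> carrier_vec (n - vec_space.rank m A) \<Longrightarrow> A *\<^sub>v (P *\<^sub>v u) = 0\<^sub>v m"
    "\<And>u. u \<in> carrier_vec (n - vec_space.rank m A) \<Longrightarrow> P *\<^sub>v u = 0\<^sub>v n \<Longrightarrow> u = 0\<^sub>v (n - vec_space.rank m A)"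
    "\<And>v. v \<in> carrier_vec n \<Longrightarrow> A *\<^sub>v v = 0\<^sub>v m \<Longrightarrow> \<exists>u\<in>carrier_vec (n - vec_space.rank m A). v = P *\<^sub>v u"
proof -
  define d where "d = n - vec_space.rank m A"
  interpret K: kernel m n A by (unfold_locales, rule A)
  obtain B where B: "finite B" "K.basis B" using kernel_basis_exists[OF A] by blast
  then have Bk: "B \<subseteq> mat_kernel A" unfolding K.Ker.basis_def by auto
  have "card B = d"
    using K.Ker.dim_basis[OF B] rank_plus_kernel_dim[OF A] unfolding d_def by simp
  moreover obtain ws where ws: "set ws = B" "distinct ws" using finite_distinct_list[OF B(1)] by blast
  ultimately have len: "length ws = d" using distinct_card by force
  have Bc: "B \<subseteq> carrier_vec n" using Bk mat_kernel_carrier[OF A] by auto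
  define P where "P = mat_of_cols n ws"
  have P: "P \<in> carrier_mat n d" unfolding P_def using len by auto
  have cols: "cols P = ws" unfolding P_def using ws Bc by (intro cols_mat_of_cols) auto
  have "K.NC.col_space P = mat_kernel A"
    using B(2) K.span_same[OF Bk] ws unfolding K.NC.col_space_def cols K.Ker.basis_def by simp
  then have range: "mat_kernel A = {y \<in> carrier_vec n. \<exists>x\<in>carrier_vec d. P *\<^sub>v x = y}"
    using K.NC.col_space_eq[OF P] P by simp
  have indep: "\<not> K.NC.lin_dep (set (cols P))"
    using B(2) K.lindep_same[OF Bk] ws unfolding K.Ker.basis_def cols by simp
  show thesis
  proof (rule that[folded d_def, OF P])
    show "A *\<^sub>v (P *\<^sub>v u) = 0\<^sub>v m" if "u \<in> carrier_vec d" for u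
      using range that P mat_kernelD(2)[OF A] by (metis (mono_tags, lifting) mem_Collect_eq mult_mat_vec_carrier)
    show "u = 0\<^sub>v d" if "u \<in> carrier_vec d" "P *\<^sub>v u = 0\<^sub>v n" for u
      using K.NC.lin_depI[OF P that(1) _ that(2)] indep cols ws by auto
    show "\<exists>u\<in>carrier_vec d. v = P *\<^sub>v u" if "v \<in> carrier_vec n" "A *\<^sub>v v = 0\<^sub>v m" for v
      using range mat_kernelI[OF A that] by auto
  qed
qed

lemma injective_square_imp_inverse:
  fixes B :: "'a :: field mat"
  assumes B: "B \<in> carrier_mat n n"
    and inj: "\<And>v. v \<in> carrier_vec n \<Longrightarrow> B *\<^sub>v v = 0\<^sub>v n \<Longrightarrow> v = 0\<^sub>v n"
  obtains D where "D \<in> carrier_mat n n" "D * B = 1\<^sub>m n" "B * D = 1\<^sub>m n"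
proof -
  have "det B \<noteq> 0" using det_0_iff_vec_prod_zero_field[OF B] inj by auto
  from det_non_zero_imp_unit[OF B this, of "()"] show ?thesis
    using that by (auto simp: Units_def ring_mat_simps)
qed

text \<open>A substitute for the operator norm: |w_i w_j| \<le> |w|^2, so the sum of the absolute
  values of the entries will do.\<close>

lemma quadratic_form_le_norm_sq:
  fixes B :: "real mat"
  assumes B: "B \<in> carrier_mat n n"
  obtains K where "0 \<le> K" "\<And>w. w \<in> carrier_vec n \<Longrightarrow> w \<bullet> (B *\<^sub>v w) \<le> K * (w \<bullet> w)"
proof
  define K where "K = (\<Sum>i\<in>{0..<n}. \<Sum>j\<in>{0..<n}. \<bar>B $$ (i,j)\<bar>)"
  show "0 \<le> K" unfolding K_def by (intro sum_nonneg) auto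
  fix w :: "real vec" assume w: "w \<in> carrier_vec n"
  have sq: "w $ i * w $ i \<le> w \<bullet> w" if "i < n" for i
    unfolding scalar_prod_def using that w
    by (intro member_le_sum[of _ _ "\<lambda>i. w $ i * w $ i"]) auto
  have prod: "\<bar>w $ i * w $ j\<bar> \<le> w \<bullet> w" if "i < n" "j < n" for i j
  proof -
    have "2 * \<bar>w $ i * w $ j\<bar> \<le> w $ i * w $ i + w $ j * w $ j"
      using sum_squares_bound[of "\<bar>w $ i\<bar>" "\<bar>w $ j\<bar>"] by (simp add: abs_mult power2_eq_square)
    then show ?thesis using sq[OF that(1)] sq[OF that(2)] by linarith
  qed
  have "w \<bullet> (B *\<^sub>v w) = (\<Sum>i\<in>{0..<n}. \<Sum>j\<in>{0..<n}. B $$ (i,j) * (w $ i * w $ j))"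
    using B w by (simp add: scalar_prod_def sum_distrib_left algebra_simps)
  also have "\<dots> \<le> (\<Sum>i\<in>{0..<n}. \<Sum>j\<in>{0..<n}. \<bar>B $$ (i,j)\<bar> * (w \<bullet> w))"
  proof (intro sum_mono)
    fix i j assume "i \<in> {0..<n}" "j \<in> {0..<n}"
    then have "\<bar>B $$ (i,j)\<bar> * \<bar>w $ i * w $ j\<bar> \<le> \<bar>B $$ (i,j)\<bar> * (w \<bullet> w)"
      using prod by (intro mult_left_mono) auto
    then show "B $$ (i,j) * (w $ i * w $ j) \<le> \<bar>B $$ (i,j)\<bar> * (w \<bullet> w)"
      by (metis abs_le_D1 abs_mult)
  qed
  also have "\<dots> = K * (w \<bullet> w)" unfolding K_def by (simp add: sum_distrib_right)
  finally show "w \<bullet> (B *\<^sub>v w) \<le> K * (w \<bullet> w)" .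
qed

lemma scalar_prod_self_nonneg: "0 \<le> v \<bullet> (v :: real vec)"
  unfolding scalar_prod_def by (intro sum_nonneg) auto

lemma scalar_prod_self_eq_0D:
  assumes "v \<in> carrier_vec n" "v \<bullet> (v :: real vec) = 0"
  shows "v = 0\<^sub>v n"
proof
  have "\<forall>i\<in>{0..<n}. v $ i * v $ i = 0"
    using assms unfolding scalar_prod_def by (subst (asm) sum_nonneg_eq_0_iff) auto
  then show "v $ i = 0\<^sub>v n $ i" if "i < dim_vec (0\<^sub>v n)" for i using that by auto
qed (use assms in auto)

section \<open>Geometry of the inner product given by a positive definite matrix\<close>

text \<open>Symmetry is required of the bilinear form, not of the matrix, since this is what the
  induction over the Gramian delivers.\<close>

locale inner_product_mat =
  fixes n :: nat and G :: "real mat"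
  assumes G: "G \<in> carrier_mat n n"
    and sym: "\<And>u v. u \<in> carrier_vec n \<Longrightarrow> v \<in> carrier_vec n \<Longrightarrow> u \<bullet> (G *\<^sub>v v) = v \<bullet> (G *\<^sub>v u)"
    and nonneg: "\<And>v. v \<in> carrier_vec n \<Longrightarrow> 0 \<le> v \<bullet> (G *\<^sub>v v)"
    and definite: "\<And>v. v \<in> carrier_vec n \<Longrightarrow> v \<bullet> (G *\<^sub>v v) = 0 \<Longrightarrow> v = 0\<^sub>v n"
begin

definition ip :: "real vec \<Rightarrow> real vec \<Rightarrow> real" where
  "ip u v = u \<bullet> (G *\<^sub>v v)"

lemma ip_commute: "u \<in> carrier_vec n \<Longrightarrow> v \<in> carrier_vec n \<Longrightarrow> ip u v = ip v u"
  unfolding ip_def by (rule sym)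

lemma ip_nonneg: "v \<in> carrier_vec n \<Longrightarrow> 0 \<le> ip v v"
  unfolding ip_def by (rule nonneg)

lemma ip_linear_simps:
  assumes "u \<in> carrier_vec n" "v \<in> carrier_vec n" "w \<in> carrier_vec n"
  shows "ip (u + v) w = ip u w + ip v w" "ip u (v + w) = ip u v + ip u w"
    "ip (u - v) w = ip u w - ip v w" "ip u (v - w) = ip u v - ip u w"
    "ip (c \<cdot>\<^sub>v u) v = c * ip u v" "ip u (c \<cdot>\<^sub>v v) = c * ip u v"
  using assms G unfolding ip_def
  by (simp_all add: add_scalar_prod_distrib[of _ n] scalar_prod_add_distrib[of _ n]
      minus_scalar_prod_distrib[of _ n] scalar_prod_minus_distrib[of _ n]
      mult_add_distrib_mat_vec[of _ n n] mult_minus_distrib_mat_vec[of _ n n] mult_mat_vec[of _ n n])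

lemma ip_zero [simp]: "v \<in> carrier_vec n \<Longrightarrow> ip (0\<^sub>v n) v = 0" "v \<in> carrier_vec n \<Longrightarrow> ip v (0\<^sub>v n) = 0"
  using ip_commute[of v "0\<^sub>v n"] G unfolding ip_def by auto

lemma ip_Cauchy_Schwarz:
  assumes u: "u \<in> carrier_vec n" and v: "v \<in> carrier_vec n"
  shows "(ip u v)\<^sup>2 \<le> ip u u * ip v v"
proof (cases "ip v v = 0")
  case True
  then have "v = 0\<^sub>v n" using definite v unfolding ip_def by blast
  then show ?thesis using u True by simp
next
  case False
  then have pos: "0 < ip v v" using ip_nonneg[OF v] by linarith
  define t where "t = ip u v / ip v v"
  have "0 \<le> ip (u - t \<cdot>\<^sub>v v) (u - t \<cdot>\<^sub>v v)" using u v by (intro ip_nonneg) auto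
  also have "\<dots> = ip u u - 2 * t * ip u v + t\<^sup>2 * ip v v"
    using u v ip_commute[OF u v] by (simp add: ip_linear_simps power2_eq_square algebra_simps)
  also have "\<dots> = ip u u - (ip u v)\<^sup>2 / ip v v"
    using pos unfolding t_def by (simp add: field_simps power2_eq_square)
  finally show ?thesis using pos by (simp add: field_simps)
qed

text \<open>The parallelogram law yields a triangle inequality for squared norms at the price of a
  factor 2. The factor is harmless: the inequality is iterated only along a path of the graph, which
  does not depend on the errors.\<close>

lemma ip_diff_diff_le:
  assumes "u \<in> carrier_vec n" "v \<in> carrier_vec n" "w \<in> carrier_vec n"
  shows "ip (u - w) (u - w) \<le> 2 * ip (u - v) (u - v) + 2 * ip (v - w) (v - w)"
proof -
  define a b where "a = u - v" and "b = v - w"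
  have ab: "a \<in> carrier_vec n" "b \<in> carrier_vec n" using assms by (auto simp: a_def b_def)
  have sum: "u - w = a + b" unfolding a_def b_def using assms by auto
  have "ip (a + b) (a + b) + ip (a - b) (a - b) = 2 * ip a a + 2 * ip b b"
    using ab ip_commute[OF ab] by (simp add: ip_linear_simps)
  moreover have "0 \<le> ip (a - b) (a - b)" using ab by (intro ip_nonneg) auto
  ultimately show ?thesis unfolding sum a_def[symmetric] b_def[symmetric] by linarith
qed

lemma ip_minus_commute:
  assumes "u \<in> carrier_vec n" "v \<in> carrier_vec n"
  shows "ip (u - v) (u - v) = ip (v - u) (v - u)"
  using assms by (simp add: ip_linear_simps)

text \<open>
  Instead of compactness of the unit sphere, the lower bound uses
  \<open>w \<bullet> w = ip (G\<inverse> w) w\<close> and the Cauchy-Schwarz inequality.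
\<close>

lemma norm_sq_le_ip:
  obtains c where "0 \<le> c" "\<And>w. w \<in> carrier_vec n \<Longrightarrow> w \<bullet> w \<le> c * ip w w"
proof -
  obtain H where H: "H \<in> carrier_mat n n" "H * G = 1\<^sub>m n" "G * H = 1\<^sub>m n"
  proof (rule injective_square_imp_inverse[OF G])
    show "v = 0\<^sub>v n" if "v \<in> carrier_vec n" "G *\<^sub>v v = 0\<^sub>v n" for v
      using definite[OF that(1)] that by simp
  qed
  have GH: "G *\<^sub>v (H *\<^sub>v w) = w" if "w \<in> carrier_vec n" for w
    using that H G assoc_mult_mat_vec[OF G H(1) that] by simp
  have "H\<^sup>T \<in> carrier_mat n n" using H by simp
  then obtain K where K: "0 \<le> K" "\<And>w. w \<in> carrier_vec n \<Longrightarrow> w \<bullet> (H\<^sup>T *\<^sub>v w) \<le> K * (w \<bullet> w)"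
    by (rule quadratic_form_le_norm_sq) blast
  have bound: "w \<bullet> w \<le> K * ip w w" if w: "w \<in> carrier_vec n" for w
  proof (cases "w \<bullet> w = 0")
    case True
    then show ?thesis using K ip_nonneg[OF w] by simp
  next
    case False
    then have pos: "0 < w \<bullet> w" using scalar_prod_self_nonneg[of w] by linarith
    have Hw: "H *\<^sub>v w \<in> carrier_vec n" using H w by simp
    have "ip (H *\<^sub>v w) (H *\<^sub>v w) = w \<bullet> (H\<^sup>T *\<^sub>v w)"
      unfolding ip_def GH[OF w]
      using transpose_vec_mult_scalar[OF H(1) w w] comm_scalar_prod[of _ n] Hw H w by (metis \<open>H\<^sup>T \<in> carrier_mat n n\<close> mult_mat_vec_carrier)
    then have le: "ip (H *\<^sub>v w) (H *\<^sub>v w) \<le> K * (w \<bullet> w)" using K(2)[OF w] by simp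
    have "ip w (H *\<^sub>v w) = w \<bullet> w" unfolding ip_def GH[OF w] ..
    then have "(w \<bullet> w)\<^sup>2 \<le> ip w w * ip (H *\<^sub>v w) (H *\<^sub>v w)"
      using ip_Cauchy_Schwarz[OF w Hw] by simp
    also have "\<dots> \<le> ip w w * (K * (w \<bullet> w))" using le ip_nonneg[OF w] by (rule mult_left_mono)
    finally have "(w \<bullet> w) * (w \<bullet> w) \<le> (K * ip w w) * (w \<bullet> w)" by (simp add: power2_eq_square ac_simps)
    then show ?thesis using pos by simp
  qed
  show thesis by (rule that[OF K(1) bound])
qed

text \<open>Later \<open>B\<close> is C_j^T C_j, so that the energy of a local output is measured
  against the inner product of \<open>G\<close>.\<close>

lemma quadratic_form_le_ip:
  assumes "B \<in> carrier_mat n n"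
  obtains K where "0 \<le> K" "\<And>w. w \<in> carrier_vec n \<Longrightarrow> w \<bullet> (B *\<^sub>v w) \<le> K * ip w w"
proof -
  obtain K where K: "0 \<le> K" "\<And>w. w \<in> carrier_vec n \<Longrightarrow> w \<bullet> (B *\<^sub>v w) \<le> K * (w \<bullet> w)"
    using quadratic_form_le_norm_sq[OF assms] by blast
  obtain c where c: "0 \<le> c" "\<And>w. w \<in> carrier_vec n \<Longrightarrow> w \<bullet> w \<le> c * ip w w"
    using norm_sq_le_ip by blast
  show thesis
  proof (rule that[of "K * c"])
    show "w \<bullet> (B *\<^sub>v w) \<le> K * c * ip w w" if "w \<in> carrier_vec n" for w
      using K(2)[OF that] mult_left_mono[OF c(2)[OF that] K(1)] by (simp add: mult.assoc)
  qed (use K c in simp)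
qed

end


section \<open>The observability Gramian of the inverted shift and the dissipation
  inequality\<close>

text \<open>A has finitely many eigenvalues, so some number \<le> - c is not one of them; s is its
  negative. The inverse is handed on through its action on vectors, so the matrix \<open>F\<close>
  stays inside the proof.\<close>

lemma exists_large_shift_inverse:
  fixes A :: "real mat"
  assumes A: "A \<in> carrier_mat n n"
  obtains s D where "c \<le> s" "D \<in> carrier_mat n n"
    "\<And>v. v \<in> carrier_vec n \<Longrightarrow> D *\<^sub>v (s \<cdot>\<^sub>v v + A *\<^sub>v v) = v"
    "\<And>v. v \<in> carrier_vec n \<Longrightarrow> s \<cdot>\<^sub>v (D *\<^sub>v v) + A *\<^sub>v (D *\<^sub>v v) = v"
proof -
  have "finite {k. poly (char_poly A) k = 0}"
    using degree_monic_char_poly[OF A] by (intro poly_roots_finite) auto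
  then have "infinite ({..- c} - {k. poly (char_poly A) k = 0})"
    using infinite_Iic by (rule Diff_infinite_finite)
  then have "{..- c} - {k. poly (char_poly A) k = 0} \<noteq> {}" by (rule infinite_imp_nonempty)
  then obtain k where "k \<le> - c" "\<not> eigenvalue A k"
    unfolding eigenvalue_root_char_poly[OF A] by blast
  moreover define s where "s = - k"
  ultimately have s: "c \<le> s" and noneig: "\<not> eigenvalue A (- s)" by auto
  define F where "F = s \<cdot>\<^sub>m 1\<^sub>m n + A"
  have F: "F \<in> carrier_mat n n" unfolding F_def using A by simp
  have Fv: "F *\<^sub>v v = s \<cdot>\<^sub>v v + A *\<^sub>v v" if "v \<in> carrier_vec n" for v
  proof -
    have "(s \<cdot>\<^sub>m 1\<^sub>m n) *\<^sub>v v = s \<cdot>\<^sub>v v"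
      using that by (intro eq_vecI) (auto simp: row_smult)
    then show ?thesis
      unfolding F_def using that A by (subst add_mult_distrib_mat_vec[of _ n n]) auto
  qed
  obtain D where D: "D \<in> carrier_mat n n" "D * F = 1\<^sub>m n" "F * D = 1\<^sub>m n"
  proof (rule injective_square_imp_inverse[OF F])
    fix v assume v: "v \<in> carrier_vec n" "F *\<^sub>v v = 0\<^sub>v n"
    have "A *\<^sub>v v = (- s) \<cdot>\<^sub>v v"
    proof
      fix i assume "i < dim_vec ((- s) \<cdot>\<^sub>v v)"
      then have i: "i < n" using v by simp
      have "(s \<cdot>\<^sub>v v + A *\<^sub>v v) $ i = 0" using v(2) i unfolding Fv[OF v(1)] by simp
      then show "(A *\<^sub>v v) $ i = ((- s) \<cdot>\<^sub>v v) $ i" using i v(1) A by simp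
    qed (use A v in auto)
    then show "v = 0\<^sub>v n" using noneig A v(1) unfolding eigenvalue_def eigenvector_def by auto
  qed
  show thesis
  proof (rule that[OF s D(1)])
    fix v :: "real vec" assume v: "v \<in> carrier_vec n"
    show "D *\<^sub>v (s \<cdot>\<^sub>v v + A *\<^sub>v v) = v"
      unfolding Fv[OF v, symmetric] using D F v assoc_mult_mat_vec[OF D(1) F v] by simp
    have "D *\<^sub>v v \<in> carrier_vec n" using D v by simp
    from Fv[OF this] show "s \<cdot>\<^sub>v (D *\<^sub>v v) + A *\<^sub>v (D *\<^sub>v v) = v"
      using D F v assoc_mult_mat_vec[OF F D(1) v] by simp
  qed
qed

text \<open>
  The finite-horizon observability Gramian \<open>\<Sum>j=1..k. (D\<^sup>T)^j C\<^sup>T C D^j\<close> of the pair \<open>(C, D)\<close>.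
\<close>

primrec gramian :: "nat \<Rightarrow> real mat \<Rightarrow> real mat \<Rightarrow> nat \<Rightarrow> real mat" where
  "gramian n C D 0 = 0\<^sub>m n n"
| "gramian n C D (Suc k) = D\<^sup>T * ((gramian n C D k + C\<^sup>T * C) * D)"

context
  fixes n l :: nat and C D :: "real mat"
  assumes C: "C \<in> carrier_mat l n" and D: "D \<in> carrier_mat n n"
begin

lemma gramian_carrier [simp]: "gramian n C D k \<in> carrier_mat n n"
  using C D by (induction k) auto

lemma gramian_0_form: "v \<in> carrier_vec n \<Longrightarrow> u \<in> carrier_vec n \<Longrightarrow> u \<bullet> (gramian n C D 0 *\<^sub>v v) = 0"
proof -
  assume uv: "v \<in> carrier_vec n" "u \<in> carrier_vec n"
  then have "0\<^sub>m n n *\<^sub>v v = 0\<^sub>v n" by (intro eq_vecI) auto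
  then show ?thesis using uv by simp
qed

text \<open>At w = F v, where D w = v, this reads w \<bullet> G_{k+1} w = v \<bullet> G_k v + |C
  v|^2, a discrete Lyapunov identity. All later facts about the Gramian rest on it.\<close>

lemma gramian_Suc_form:
  assumes u: "u \<in> carrier_vec n" and v: "v \<in> carrier_vec n"
  shows "u \<bullet> (gramian n C D (Suc k) *\<^sub>v v) =
    (D *\<^sub>v u) \<bullet> (gramian n C D k *\<^sub>v (D *\<^sub>v v)) + (C *\<^sub>v (D *\<^sub>v u)) \<bullet> (C *\<^sub>v (D *\<^sub>v v))"
proof -
  let ?G = "gramian n C D k"
  have Du: "D *\<^sub>v u \<in> carrier_vec n" and Dv: "D *\<^sub>v v \<in> carrier_vec n" using D u v by auto
  have S: "?G + C\<^sup>T * C \<in> carrier_mat n n" using C by simp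
  have SDv: "(?G + C\<^sup>T * C) *\<^sub>v (D *\<^sub>v v) \<in> carrier_vec n" using S Dv by (rule mult_mat_vec_carrier)
  have CT: "C\<^sup>T \<in> carrier_mat n l" using C by simp
  have "gramian n C D (Suc k) *\<^sub>v v = D\<^sup>T *\<^sub>v ((?G + C\<^sup>T * C) *\<^sub>v (D *\<^sub>v v))"
    using S D v assoc_mult_mat_vec[of "D\<^sup>T" n n "(?G + C\<^sup>T * C) * D" n v]
      assoc_mult_mat_vec[OF S D v] by simp
  then have "u \<bullet> (gramian n C D (Suc k) *\<^sub>v v) = (D *\<^sub>v u) \<bullet> ((?G + C\<^sup>T * C) *\<^sub>v (D *\<^sub>v v))"
    using transpose_vec_mult_scalar[of "D\<^sup>T" n n "(?G + C\<^sup>T * C) *\<^sub>v (D *\<^sub>v v)" u] D u SDv by simp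
  also have "(?G + C\<^sup>T * C) *\<^sub>v (D *\<^sub>v v) = ?G *\<^sub>v (D *\<^sub>v v) + C\<^sup>T *\<^sub>v (C *\<^sub>v (D *\<^sub>v v))"
    using add_mult_distrib_mat_vec[of ?G n n "C\<^sup>T * C" "D *\<^sub>v v"] C Dv assoc_mult_mat_vec[OF CT C Dv] by simp
  also have "(D *\<^sub>v u) \<bullet> \<dots> = (D *\<^sub>v u) \<bullet> (?G *\<^sub>v (D *\<^sub>v v)) + (D *\<^sub>v u) \<bullet> (C\<^sup>T *\<^sub>v (C *\<^sub>v (D *\<^sub>v v)))"
    using Du Dv C CT by (intro scalar_prod_add_distrib[of _ n]) (auto intro!: mult_mat_vec_carrier[of _ n n])
  also have "(D *\<^sub>v u) \<bullet> (C\<^sup>T *\<^sub>v (C *\<^sub>v (D *\<^sub>v v))) = (C *\<^sub>v (D *\<^sub>v u)) \<bullet> (C *\<^sub>v (D *\<^sub>v v))"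
    using transpose_vec_mult_scalar[OF CT _ Du, of "C *\<^sub>v (D *\<^sub>v v)"] C Dv by simp
  finally show ?thesis .
qed

lemma gramian_sym:
  "u \<in> carrier_vec n \<Longrightarrow> v \<in> carrier_vec n \<Longrightarrow>
    u \<bullet> (gramian n C D k *\<^sub>v v) = v \<bullet> (gramian n C D k *\<^sub>v u)"
proof (induction k arbitrary: u v)
  case (Suc k)
  have car: "D *\<^sub>v u \<in> carrier_vec n" "D *\<^sub>v v \<in> carrier_vec n" using D Suc.prems by auto
  show ?case
    unfolding gramian_Suc_form[OF Suc.prems] gramian_Suc_form[OF Suc.prems(2,1)]
    using Suc.IH[OF car] comm_scalar_prod[of "C *\<^sub>v (D *\<^sub>v u)" l "C *\<^sub>v (D *\<^sub>v v)"] C car by simp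
qed (use gramian_0_form in simp)

lemma gramian_form_nonneg: "v \<in> carrier_vec n \<Longrightarrow> 0 \<le> v \<bullet> (gramian n C D k *\<^sub>v v)"
proof (induction k arbitrary: v)
  case (Suc k)
  then show ?case
    using D scalar_prod_self_nonneg unfolding gramian_Suc_form[OF Suc.prems Suc.prems]
    by (intro add_nonneg_nonneg) auto
qed (use gramian_0_form in simp)

text \<open>Passing from k to k + 1 adds |C D^(k+1) v|^2. The induction avoids the explicit sum: the
  increment at v is the previous increment at D v, and the first increment is a nonnegative
  form.\<close>

lemma gramian_form_mono:
  "v \<in> carrier_vec n \<Longrightarrow> v \<bullet> (gramian n C D k *\<^sub>v v) \<le> v \<bullet> (gramian n C D (Suc k) *\<^sub>v v)"
proof (induction k arbitrary: v)
  case 0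
  then show ?case using gramian_form_nonneg[OF 0, of "Suc 0"] gramian_0_form[OF 0 0] by (simp del: gramian.simps)
next
  case (Suc k)
  have Dv: "D *\<^sub>v v \<in> carrier_vec n" using D Suc.prems by auto
  show ?case
    using Suc.IH[OF Dv]
    unfolding gramian_Suc_form[OF Suc.prems Suc.prems, of "Suc k"] gramian_Suc_form[OF Suc.prems Suc.prems, of k]
    by simp
qed

context
  fixes A :: "real mat" and s :: real
  assumes A: "A \<in> carrier_mat n n"
    and left_inv: "\<And>v. v \<in> carrier_vec n \<Longrightarrow> D *\<^sub>v (s \<cdot>\<^sub>v v + A *\<^sub>v v) = v"
    and right_inv: "\<And>v. v \<in> carrier_vec n \<Longrightarrow> s \<cdot>\<^sub>v (D *\<^sub>v v) + A *\<^sub>v (D *\<^sub>v v) = v"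
begin

text \<open>With the horizon on the left raised by one this is an equality; monotonicity in the
  horizon brings it back to the same Gramian on both sides.\<close>

lemma gramian_form_le_shifted:
  assumes v: "v \<in> carrier_vec n"
  defines "w \<equiv> s \<cdot>\<^sub>v v + A *\<^sub>v v"
  shows "w \<bullet> (gramian n C D k *\<^sub>v w) \<le> v \<bullet> (gramian n C D k *\<^sub>v v) + (C *\<^sub>v v) \<bullet> (C *\<^sub>v v)"
proof -
  have w: "w \<in> carrier_vec n" unfolding w_def using v A by auto
  have "w \<bullet> (gramian n C D (Suc k) *\<^sub>v w) = v \<bullet> (gramian n C D k *\<^sub>v v) + (C *\<^sub>v v) \<bullet> (C *\<^sub>v v)"
    unfolding gramian_Suc_form[OF w w] unfolding w_def left_inv[OF v] ..
  then show ?thesis using gramian_form_mono[OF w, of k] by simp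
qed

text \<open>At F^k w the form is the sum of |C F^i w|^2 over i < k, so its vanishing kills every C
  F^i w. As F = s I + A, this amounts to C A^i w = 0 for i < k. The induction uses A^k w = A^(k-1) F
  w - s A^(k-1) w and so needs its hypothesis both at w and at F w, which is why \<open>w\<close> is
  generalised.\<close>

lemma gramian_form_eq_0D:
  assumes "w \<in> carrier_vec n"
    and "(((\<lambda>v. s \<cdot>\<^sub>v v + A *\<^sub>v v) ^^ k) w) \<bullet> (gramian n C D k *\<^sub>v (((\<lambda>v. s \<cdot>\<^sub>v v + A *\<^sub>v v) ^^ k) w)) = 0"
    and "i < k"
  shows "C *\<^sub>v ((A ^\<^sub>m i) *\<^sub>v w) = 0\<^sub>v l"
  using assms
proof (induction k arbitrary: w i)
  case (Suc k)
  define f where "f = (\<lambda>v. s \<cdot>\<^sub>v v + A *\<^sub>v v)"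
  define q where "q j v = v \<bullet> (gramian n C D j *\<^sub>v v)" for j v
  have fc: "f v \<in> carrier_vec n" if "v \<in> carrier_vec n" for v using that A unfolding f_def by simp
  have fkc: "(f ^^ j) v \<in> carrier_vec n" if "v \<in> carrier_vec n" for v j
    using that fc by (induction j) auto
  note w = Suc.prems(1)
  have IH: "C *\<^sub>v ((A ^\<^sub>m i) *\<^sub>v v) = 0\<^sub>v l" if "v \<in> carrier_vec n" "q k ((f ^^ k) v) = 0" "i < k" for v i
    using Suc.IH[OF that(1) _ that(3)] that(2) unfolding q_def f_def by simp
  have "q (Suc k) (f ((f ^^ k) w)) = q k ((f ^^ k) w) + (C *\<^sub>v (f ^^ k) w) \<bullet> (C *\<^sub>v (f ^^ k) w)"
    unfolding q_def gramian_Suc_form[OF fc fc, OF fkc fkc, OF w w]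
    using left_inv[OF fkc[OF w]] unfolding f_def by simp
  moreover have q0: "q (Suc k) (f ((f ^^ k) w)) = 0"
    using Suc.prems(2) unfolding q_def f_def by simp
  moreover have "0 \<le> q k ((f ^^ k) w)" unfolding q_def using gramian_form_nonneg[OF fkc[OF w]] .
  moreover have "0 \<le> (C *\<^sub>v (f ^^ k) w) \<bullet> (C *\<^sub>v (f ^^ k) w)" by (rule scalar_prod_self_nonneg)
  ultimately have qk: "q k ((f ^^ k) w) = 0" and Ck: "(C *\<^sub>v (f ^^ k) w) \<bullet> (C *\<^sub>v (f ^^ k) w) = 0"
    by linarith+
  \<comment> \<open>At F^(k+1) w = F^k (F w) the form of horizon k is squeezed between 0 and that of
    horizon k + 1. This makes the induction hypothesis available at F w.\<close>
  have "q k (f ((f ^^ k) w)) = 0"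
    using q0 gramian_form_mono[OF fc[OF fkc[OF w]], of k k] gramian_form_nonneg[OF fc[OF fkc[OF w]], of k k]
    unfolding q_def by simp
  then have qf: "q k ((f ^^ k) (f w)) = 0" by (simp add: funpow_swap1)
  show ?case
  proof (cases "i < k")
    case True
    then show ?thesis using IH[OF w qk] by simp
  next
    case False
    then have i: "i = k" using Suc.prems(3) by simp
    show ?thesis
    proof (cases k)
      case 0
      have "C *\<^sub>v w = 0\<^sub>v l"
        using Ck C w unfolding 0 by (intro scalar_prod_self_eq_0D) auto
      then show ?thesis using i 0 w A by simp
    next
      case (Suc j)
      have Aj: "A ^\<^sub>m j \<in> carrier_mat n n" using A by simp
      have Ajw: "A ^\<^sub>m j *\<^sub>v w \<in> carrier_vec n" "A ^\<^sub>m j *\<^sub>v (A *\<^sub>v w) \<in> carrier_vec n"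
        using A w by (auto intro!: mult_mat_vec_carrier[OF Aj])
      have "0\<^sub>v l = C *\<^sub>v ((A ^\<^sub>m j) *\<^sub>v f w)" using IH[OF fc[OF w] qf] Suc by simp
      also have "\<dots> = s \<cdot>\<^sub>v (C *\<^sub>v ((A ^\<^sub>m j) *\<^sub>v w)) + C *\<^sub>v ((A ^\<^sub>m j) *\<^sub>v (A *\<^sub>v w))"
        using C A w Ajw unfolding f_def
        by (simp add: mult_add_distrib_mat_vec[OF Aj] mult_mat_vec[OF Aj] mult_add_distrib_mat_vec[OF C] mult_mat_vec[OF C])
      also have "C *\<^sub>v ((A ^\<^sub>m j) *\<^sub>v w) = 0\<^sub>v l" using IH[OF w qk, of j] Suc by simp
      also have "(A ^\<^sub>m j) *\<^sub>v (A *\<^sub>v w) = (A ^\<^sub>m k) *\<^sub>v w"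
        unfolding Suc using assoc_mult_mat_vec[OF Aj A w] by simp
      finally have "0\<^sub>v l = s \<cdot>\<^sub>v 0\<^sub>v l + C *\<^sub>v ((A ^\<^sub>m k) *\<^sub>v w)" .
      moreover have "s \<cdot>\<^sub>v 0\<^sub>v l = 0\<^sub>v l" by (intro eq_vecI) auto
      moreover have "C *\<^sub>v ((A ^\<^sub>m k) *\<^sub>v w) \<in> carrier_vec l"
        using mult_mat_vec_carrier[OF C mult_mat_vec_carrier[OF pow_carrier_mat[OF A] w]] .
      ultimately show ?thesis unfolding i by (metis left_zero_vec)
    qed
  qed
qed simp

text \<open>Horizon n suffices because observability tests only the powers below n. A vector v on
  which the form vanishes is written as F^n w with w = D^n v; observability gives w = 0, hence v =
  0.\<close>

lemma gramian_inner_product: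
  assumes obs: "\<And>w. w \<in> carrier_vec n \<Longrightarrow> (\<And>k. k < n \<Longrightarrow> C *\<^sub>v ((A ^\<^sub>m k) *\<^sub>v w) = 0\<^sub>v l) \<Longrightarrow> w = 0\<^sub>v n"
  shows "inner_product_mat n (gramian n C D n)"
proof
  fix v :: "real vec" assume v: "v \<in> carrier_vec n" "v \<bullet> (gramian n C D n *\<^sub>v v) = 0"
  define f where "f = (\<lambda>v. s \<cdot>\<^sub>v v + A *\<^sub>v v)"
  define w where "w k = (((*\<^sub>v) D) ^^ k) v" for k
  have w: "w k \<in> carrier_vec n" for k unfolding w_def using v D by (induction k) auto
  have fw: "(f ^^ k) (w k) = v" for k
  proof (induction k)
    case (Suc k)
    have "(f ^^ Suc k) (w (Suc k)) = (f ^^ k) (f (D *\<^sub>v w k))"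
      unfolding w_def by (simp add: funpow_swap1)
    then show ?case using Suc right_inv[OF w] unfolding f_def by simp
  qed (simp add: w_def)
  have "w n = 0\<^sub>v n"
  proof (rule obs[OF w])
    show "C *\<^sub>v ((A ^\<^sub>m k) *\<^sub>v w n) = 0\<^sub>v l" if "k < n" for k
      using gramian_form_eq_0D[OF w _ that] v(2) fw[of n] unfolding f_def by simp
  qed
  moreover have "(f ^^ k) (0\<^sub>v n) = 0\<^sub>v n" for k
    using A unfolding f_def by (induction k) auto
  ultimately show "v = 0\<^sub>v n" using fw[of n] by simp
qed (auto simp: gramian_sym gramian_form_nonneg)

end

end

text \<open>Expand <F v, F v> = s^2 <v, v> + 2 s <v, A v> + <A v, A v> in the inequality for the
  shifted vector, drop the last square and divide by 2 s. The result is the rate (s^2 - 1) / (2 s)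
  with kappa = 1 / (2 s).\<close>

lemma observable_imp_stabilizing_form:
  fixes A C :: "real mat"
  assumes A: "A \<in> carrier_mat n n" and C: "C \<in> carrier_mat l n"
    and obs: "\<And>w. w \<in> carrier_vec n \<Longrightarrow> (\<And>k. k < n \<Longrightarrow> C *\<^sub>v ((A ^\<^sub>m k) *\<^sub>v w) = 0\<^sub>v l) \<Longrightarrow> w = 0\<^sub>v n"
    and \<sigma>: "0 \<le> \<sigma>"
  obtains G \<kappa> where "inner_product_mat n G" "0 \<le> \<kappa>"
    "\<And>v. v \<in> carrier_vec n \<Longrightarrow>
      v \<bullet> (G *\<^sub>v (A *\<^sub>v v)) \<le> - \<sigma> * (v \<bullet> (G *\<^sub>v v)) + \<kappa> * ((C *\<^sub>v v) \<bullet> (C *\<^sub>v v))"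
proof -
  \<comment> \<open>This bound on s ensures s^2 - 1 \<ge> 2 s sigma: multiply it by s + 1.\<close>
  obtain s D where s: "2 * \<sigma> + 1 \<le> s" and D: "D \<in> carrier_mat n n"
    and inv: "\<And>v. v \<in> carrier_vec n \<Longrightarrow> D *\<^sub>v (s \<cdot>\<^sub>v v + A *\<^sub>v v) = v"
      "\<And>v. v \<in> carrier_vec n \<Longrightarrow> s \<cdot>\<^sub>v (D *\<^sub>v v) + A *\<^sub>v (D *\<^sub>v v) = v"
    using exists_large_shift_inverse[OF A] by blast
  interpret inner_product_mat n "gramian n C D n"
    by (rule gramian_inner_product[OF C D A inv obs])
  have s0: "0 < s" using s \<sigma> by simp
  show thesis
  proof (rule that)
    show "inner_product_mat n (gramian n C D n)" by unfold_locales
    show "0 \<le> 1 / (2 * s)" using s0 by simp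
    fix v :: "real vec" assume v: "v \<in> carrier_vec n"
    have Av: "A *\<^sub>v v \<in> carrier_vec n" using A v by simp
    define c where "c = (C *\<^sub>v v) \<bullet> (C *\<^sub>v v)"
    have "ip (s \<cdot>\<^sub>v v + A *\<^sub>v v) (s \<cdot>\<^sub>v v + A *\<^sub>v v) \<le> ip v v + c"
      using gramian_form_le_shifted[OF C D A inv v] unfolding ip_def c_def .
    moreover have "ip (s \<cdot>\<^sub>v v + A *\<^sub>v v) (s \<cdot>\<^sub>v v + A *\<^sub>v v) =
        s * s * ip v v + 2 * s * ip v (A *\<^sub>v v) + ip (A *\<^sub>v v) (A *\<^sub>v v)"
      using v Av ip_commute[OF v Av] by (simp add: ip_linear_simps algebra_simps)
    moreover have "0 \<le> ip (A *\<^sub>v v) (A *\<^sub>v v)" using Av by (rule ip_nonneg)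
    moreover have "2 * s * \<sigma> * ip v v \<le> (s * s - 1) * ip v v"
    proof (rule mult_right_mono)
      have "(2 * \<sigma> + 1) * (s + 1) \<le> s * (s + 1)" using s s0 by (intro mult_right_mono) auto
      then show "2 * s * \<sigma> \<le> s * s - 1" using \<sigma> by (simp add: algebra_simps)
    qed (rule ip_nonneg[OF v])
    ultimately have "2 * s * ip v (A *\<^sub>v v) \<le> 2 * s * (- \<sigma> * ip v v) + c"
      by (simp add: algebra_simps)
    then have "ip v (A *\<^sub>v v) \<le> - \<sigma> * ip v v + c / (2 * s)" using s0 by (simp add: field_simps)
    then show "v \<bullet> (gramian n C D n *\<^sub>v (A *\<^sub>v v)) \<le>
        - \<sigma> * (v \<bullet> (gramian n C D n *\<^sub>v v)) + 1 / (2 * s) * ((C *\<^sub>v v) \<bullet> (C *\<^sub>v v))"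
      unfolding ip_def c_def by simp
  qed
qed

section \<open>Orthogonal projection onto the kernel of a local output matrix\<close>

lemma transpose_mult_self_form:
  fixes H :: "real mat"
  assumes H: "H \<in> carrier_mat l n" and u: "u \<in> carrier_vec n" and v: "v \<in> carrier_vec n"
  shows "u \<bullet> ((H\<^sup>T * H) *\<^sub>v v) = (H *\<^sub>v u) \<bullet> (H *\<^sub>v v)"
proof -
  have HT: "H\<^sup>T \<in> carrier_mat n l" using H by simp
  have Hv: "H *\<^sub>v v \<in> carrier_vec l" using H v by (rule mult_mat_vec_carrier)
  show ?thesis
    unfolding assoc_mult_mat_vec[OF HT H v]
    using transpose_vec_mult_scalar[OF HT Hv u] H by simp
qed

context inner_product_mat
begin

text \<open>P S is the orthogonal projection onto ker C for the inner product of \<open>G\<close>,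
  and Q C is the complementary one. The latter factors through C because it vanishes on ker C: the
  part of x that a node does not estimate can be computed from its measurement alone.\<close>

lemma orthogonal_splitting:
  fixes C :: "real mat"
  assumes C: "C \<in> carrier_mat m n"
  defines "d \<equiv> n - vec_space.rank m C"
  obtains P S Q where "P \<in> carrier_mat n d" "S \<in> carrier_mat d n" "Q \<in> carrier_mat n m"
    "\<And>u. u \<in> carrier_vec d \<Longrightarrow> C *\<^sub>v (P *\<^sub>v u) = 0\<^sub>v m"
    "\<And>x. x \<in> carrier_vec n \<Longrightarrow> P *\<^sub>v (S *\<^sub>v x) + Q *\<^sub>v (C *\<^sub>v x) = x"
    "\<And>u w. u \<in> carrier_vec d \<Longrightarrow> w \<in> carrier_vec n \<Longrightarrow>
      ip (P *\<^sub>v u) (P *\<^sub>v (S *\<^sub>v w)) = ip (P *\<^sub>v u) w"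
proof -
  obtain P where P: "P \<in> carrier_mat n d"
    and CP: "\<And>u. u \<in> carrier_vec d \<Longrightarrow> C *\<^sub>v (P *\<^sub>v u) = 0\<^sub>v m"
    and injP: "\<And>u. u \<in> carrier_vec d \<Longrightarrow> P *\<^sub>v u = 0\<^sub>v n \<Longrightarrow> u = 0\<^sub>v d"
    and kerC: "\<And>v. v \<in> carrier_vec n \<Longrightarrow> C *\<^sub>v v = 0\<^sub>v m \<Longrightarrow> \<exists>u\<in>carrier_vec d. v = P *\<^sub>v u"
    by (rule kernel_basis_matrix[OF C, folded d_def]) (rule that)
  have Pu: "P *\<^sub>v u \<in> carrier_vec n" if "u \<in> carrier_vec d" for u
    using P that by (rule mult_mat_vec_carrier)
  have PT: "P\<^sup>T \<in> carrier_mat d n" using P by simp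
  \<comment> \<open>The entries of H w are the inner products of w with the kernel basis, so the
    kernel of \<open>H\<close> is the orthogonal complement of ker C.\<close>
  define H where "H = P\<^sup>T * G"
  have H: "H \<in> carrier_mat d n" unfolding H_def using P G by simp
  have Hw: "H *\<^sub>v w \<in> carrier_vec d" if "w \<in> carrier_vec n" for w
    using H that by (rule mult_mat_vec_carrier)
  have ipH: "u \<bullet> (H *\<^sub>v w) = ip (P *\<^sub>v u) w" if "u \<in> carrier_vec d" "w \<in> carrier_vec n" for u w
    unfolding ip_def H_def assoc_mult_mat_vec[OF PT G that(2)]
    using transpose_vec_mult_scalar[OF PT mult_mat_vec_carrier[OF G that(2)] that(1)] by simp
  define X where "X = H * P"
  have X: "X \<in> carrier_mat d d" unfolding X_def using H P by simp
  have Xu: "X *\<^sub>v u = H *\<^sub>v (P *\<^sub>v u)" if "u \<in> carrier_vec d" for u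
    unfolding X_def using assoc_mult_mat_vec[OF H P that] .
  obtain Y where Y: "Y \<in> carrier_mat d d" "X * Y = 1\<^sub>m d"
  proof (rule injective_square_imp_inverse[OF X])
    fix u assume u: "u \<in> carrier_vec d" "X *\<^sub>v u = 0\<^sub>v d"
    have "u \<bullet> (H *\<^sub>v (P *\<^sub>v u)) = 0" unfolding Xu[OF u(1), symmetric] u(2) using u(1) by simp
    then have "ip (P *\<^sub>v u) (P *\<^sub>v u) = 0" unfolding ipH[OF u(1) Pu[OF u(1)]] .
    then show "u = 0\<^sub>v d" using injP[OF u(1)] definite[OF Pu[OF u(1)]] unfolding ip_def by simp
  qed
  \<comment> \<open>\<open>X\<close> is the Gram matrix of the kernel basis, so solving the normal
    equations with its inverse \<open>Y\<close> gives the coordinates of the projection.\<close>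
  define S where "S = Y * H"
  have S: "S \<in> carrier_mat d n" unfolding S_def using Y H by simp
  have Sw: "S *\<^sub>v w \<in> carrier_vec d" if "w \<in> carrier_vec n" for w
    using S that by (rule mult_mat_vec_carrier)
  have HPS: "H *\<^sub>v (P *\<^sub>v (S *\<^sub>v w)) = H *\<^sub>v w" if "w \<in> carrier_vec n" for w
  proof -
    have "H *\<^sub>v (P *\<^sub>v (S *\<^sub>v w)) = X *\<^sub>v (Y *\<^sub>v (H *\<^sub>v w))"
      using Xu[OF Sw[OF that]] assoc_mult_mat_vec[OF Y(1) H that] unfolding S_def by metis
    also have "\<dots> = H *\<^sub>v w"
      unfolding assoc_mult_mat_vec[OF X Y(1) Hw[OF that], symmetric] Y(2) using Hw[OF that] by simp
    finally show ?thesis .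
  qed
  text \<open>\<open>Z\<close> acts as \<open>C\<^sup>T C\<close> on the orthogonal complement of the kernel of \<open>C\<close>.\<close>
  define Z where "Z = C\<^sup>T * C + H\<^sup>T * H"
  have Z: "Z \<in> carrier_mat n n" unfolding Z_def using C H by simp
  have Zw: "Z *\<^sub>v w = (C\<^sup>T * C) *\<^sub>v w + (H\<^sup>T * H) *\<^sub>v w" if "w \<in> carrier_vec n" for w
    unfolding Z_def using C H that by (intro add_mult_distrib_mat_vec[of _ n n]) auto
  obtain T where T: "T \<in> carrier_mat n n" "T * Z = 1\<^sub>m n"
  proof (rule injective_square_imp_inverse[OF Z])
    fix w assume w: "w \<in> carrier_vec n" "Z *\<^sub>v w = 0\<^sub>v n"
    have "w \<bullet> (Z *\<^sub>v w) = (C *\<^sub>v w) \<bullet> (C *\<^sub>v w) + (H *\<^sub>v w) \<bullet> (H *\<^sub>v w)"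
      unfolding Zw[OF w(1)] transpose_mult_self_form[OF C w(1) w(1), symmetric]
        transpose_mult_self_form[OF H w(1) w(1), symmetric]
      using C H w(1) by (intro scalar_prod_add_distrib[of _ n] mult_mat_vec_carrier[of _ n n]) auto
    then have "(C *\<^sub>v w) \<bullet> (C *\<^sub>v w) + (H *\<^sub>v w) \<bullet> (H *\<^sub>v w) = 0" using w by simp
    then have "(C *\<^sub>v w) \<bullet> (C *\<^sub>v w) = 0" "(H *\<^sub>v w) \<bullet> (H *\<^sub>v w) = 0"
      using scalar_prod_self_nonneg[of "C *\<^sub>v w"] scalar_prod_self_nonneg[of "H *\<^sub>v w"] by linarith+
    then have Cw: "C *\<^sub>v w = 0\<^sub>v m" and Hw0: "H *\<^sub>v w = 0\<^sub>v d"
      using scalar_prod_self_eq_0D mult_mat_vec_carrier[OF C w(1)] Hw[OF w(1)] by blast+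
    obtain u where u: "u \<in> carrier_vec d" "w = P *\<^sub>v u" using kerC[OF w(1) Cw] by blast
    have "ip w w = 0" using ipH[OF u(1) w(1)] Hw0 u by simp
    then show "w = 0\<^sub>v n" using definite[OF w(1)] unfolding ip_def by simp
  qed
  \<comment> \<open>Thus \<open>Q\<close> is a left inverse of \<open>C\<close> on that complement.
    Going through \<open>Z\<close> also covers a \<open>C\<close> with dependent rows, for which C
    C^T is singular.\<close>
  define Q where "Q = T * C\<^sup>T"
  have Q: "Q \<in> carrier_mat n m" unfolding Q_def using T C by simp
  show thesis
  proof (rule that[OF P S Q CP])
    fix x :: "real vec" assume x: "x \<in> carrier_vec n"
    define w where "w = x - P *\<^sub>v (S *\<^sub>v x)"
    have PSx: "P *\<^sub>v (S *\<^sub>v x) \<in> carrier_vec n" using Pu Sw x by blast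
    have w: "w \<in> carrier_vec n" unfolding w_def using x PSx by simp
    have Cw: "C *\<^sub>v w = C *\<^sub>v x"
      unfolding w_def mult_minus_distrib_mat_vec[OF C x PSx] CP[OF Sw[OF x]]
      using mult_mat_vec_carrier[OF C x] by (intro eq_vecI) auto
    have "H *\<^sub>v w = 0\<^sub>v d"
      unfolding w_def mult_minus_distrib_mat_vec[OF H x PSx] HPS[OF x]
      using Hw[OF x] by simp
    then have "(H\<^sup>T * H) *\<^sub>v w = 0\<^sub>v n"
      using assoc_mult_mat_vec[of "H\<^sup>T" n d H n w] H w by (auto intro!: eq_vecI)
    moreover have "(C\<^sup>T * C) *\<^sub>v w = C\<^sup>T *\<^sub>v (C *\<^sub>v x)"
      using assoc_mult_mat_vec[of "C\<^sup>T" n m C n w] C w Cw by simp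
    moreover have CTCx: "C\<^sup>T *\<^sub>v (C *\<^sub>v x) \<in> carrier_vec n"
      using C by (auto intro!: mult_mat_vec_carrier[of _ n m] mult_mat_vec_carrier[OF C x])
    ultimately have "Z *\<^sub>v w = C\<^sup>T *\<^sub>v (C *\<^sub>v x)" unfolding Zw[OF w] by simp
    then have "T *\<^sub>v (C\<^sup>T *\<^sub>v (C *\<^sub>v x)) = w"
      using assoc_mult_mat_vec[OF T(1) Z w] T(2) w by simp
    moreover have "Q *\<^sub>v (C *\<^sub>v x) = T *\<^sub>v (C\<^sup>T *\<^sub>v (C *\<^sub>v x))"
      unfolding Q_def using C T mult_mat_vec_carrier[OF C x] by (intro assoc_mult_mat_vec[of _ n n _ m]) auto
    ultimately have "Q *\<^sub>v (C *\<^sub>v x) = x - P *\<^sub>v (S *\<^sub>v x)" unfolding w_def by simp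
    moreover have "a + (x - a) = x" if "a \<in> carrier_vec n" for a
      using that x by (intro eq_vecI) auto
    ultimately show "P *\<^sub>v (S *\<^sub>v x) + Q *\<^sub>v (C *\<^sub>v x) = x"
      using PSx by simp
  next
    fix u w :: "real vec" assume u: "u \<in> carrier_vec d" and w: "w \<in> carrier_vec n"
    show "ip (P *\<^sub>v u) (P *\<^sub>v (S *\<^sub>v w)) = ip (P *\<^sub>v u) w"
      using ipH[OF u Pu[OF Sw[OF w]]] ipH[OF u w] HPS[OF w] by simp
  qed
qed

lemma ip_finsum_vec:
  assumes "finite F" "u \<in> carrier_vec n" "\<And>j. j \<in> F \<Longrightarrow> f j \<in> carrier_vec n"
  shows "ip u (finsum_vec TYPE(real) n f F) = (\<Sum>j\<in>F. ip u (f j))"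
  using assms
proof (induction F rule: finite_induct)
  case empty
  then show ?case by (simp add: finsum_vec_empty)
next
  case (insert j F)
  have f: "f \<in> F \<rightarrow> carrier_vec n" "f j \<in> carrier_vec n" using insert.prems by auto
  have "finsum_vec TYPE(real) n f F \<in> carrier_vec n" using finsum_vec_closed[OF f(1)] .
  then show ?case
    using insert f by (simp add: finsum_vec_insert ip_linear_simps)
qed

end

section \<open>Disagreement on the weighted graph\<close>

text \<open>Column j of r L = 0 says that the arc weights r_i a_ij are balanced: what leaves node j
  equals what enters it. A self-loop adds the same term to both sides.\<close>

lemma laplacian_left_kernel_balance:
  assumes W: "W \<in> carrier_mat N N" and r: "r \<in> carrier_vec N"
    and r_left: "mat_of_row r * laplacian N W = 0\<^sub>m 1 N" and j: "j < N"
  shows "(\<Sum>i<N. r $ i * W $$ (i, j)) = r $ j * (\<Sum>k<N. W $$ (j, k))"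
proof -
  have "0 = (mat_of_row r * laplacian N W) $$ (0, j)" using r_left j by simp
  also have "\<dots> = (\<Sum>i<N. r $ i * laplacian N W $$ (i, j))"
    using r W j by (simp add: laplacian_def mat_diag_def scalar_prod_def atLeast0LessThan)
  also have "\<dots> = (\<Sum>i<N. (if i = j then r $ i * (\<Sum>k<N. W $$ (i, k)) else 0) - r $ i * W $$ (i, j))"
    using W j by (intro sum.cong) (auto simp: laplacian_def mat_diag_def algebra_simps)
  also have "\<dots> = r $ j * (\<Sum>k<N. W $$ (j, k)) - (\<Sum>i<N. r $ i * W $$ (i, j))"
    using j by (simp add: sum_subtractf)
  finally show ?thesis by simp
qed

context inner_product_mat
begin

text \<open>When r L = 0, this is the quadratic form of the symmetrised Laplacian R L + L^T R with R
  = diag r, taken in the inner product of \<open>G\<close>.\<close>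

definition disagreement :: "nat \<Rightarrow> real mat \<Rightarrow> real vec \<Rightarrow> (nat \<Rightarrow> real vec) \<Rightarrow> real" where
  "disagreement N W r e = (\<Sum>i<N. \<Sum>j<N. r $ i * W $$ (i, j) * ip (e i - e j) (e i - e j))"

text \<open>Polarisation: <e_i, e_j - e_i> = (|e_j|^2 - |e_i|^2) / 2 - |e_i - e_j|^2 / 2. Summed
  with the weights r_i a_ij, the first parts cancel by balance; this is the reason for the factor
  r_i in the observer gain.\<close>

lemma coupling_eq_disagreement:
  assumes W: "W \<in> carrier_mat N N" and r: "r \<in> carrier_vec N"
    and r_left: "mat_of_row r * laplacian N W = 0\<^sub>m 1 N"
    and e: "\<And>i. i < N \<Longrightarrow> e i \<in> carrier_vec n"
  shows "(\<Sum>i<N. r $ i * ip (e i) (finsum_vec TYPE(real) n (\<lambda>j. W $$ (i, j) \<cdot>\<^sub>v (e j - e i)) {..<N})) =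
    - (disagreement N W r e / 2)"
proof -
  define q where "q i = ip (e i) (e i)" for i
  have "r $ i * ip (e i) (finsum_vec TYPE(real) n (\<lambda>j. W $$ (i, j) \<cdot>\<^sub>v (e j - e i)) {..<N}) =
      (\<Sum>j<N. r $ i * W $$ (i, j) * ((q j - q i) / 2 - ip (e i - e j) (e i - e j) / 2))" if i: "i < N" for i
  proof -
    have "ip (e i) (W $$ (i, j) \<cdot>\<^sub>v (e j - e i)) =
        W $$ (i, j) * ((q j - q i) / 2 - ip (e i - e j) (e i - e j) / 2)" if "j < N" for j
      using e[OF i] e[OF that] ip_commute[OF e[OF i] e[OF that]] unfolding q_def
      by (simp add: ip_linear_simps field_simps)
    then show ?thesis
      using e i by (subst ip_finsum_vec) (auto simp: sum_distrib_left mult.assoc intro!: sum.cong)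
  qed
  then have "(\<Sum>i<N. r $ i * ip (e i) (finsum_vec TYPE(real) n (\<lambda>j. W $$ (i, j) \<cdot>\<^sub>v (e j - e i)) {..<N})) =
      (\<Sum>i<N. \<Sum>j<N. r $ i * W $$ (i, j) * ((q j - q i) / 2 - ip (e i - e j) (e i - e j) / 2))"
    by simp
  also have "\<dots> = ((\<Sum>i<N. \<Sum>j<N. r $ i * W $$ (i, j) * q j) - (\<Sum>i<N. \<Sum>j<N. r $ i * W $$ (i, j) * q i)) / 2
      - disagreement N W r e / 2"
    unfolding disagreement_def
    by (simp add: algebra_simps sum_subtractf sum.distrib sum_divide_distrib diff_divide_distrib)
  also have "(\<Sum>i<N. \<Sum>j<N. r $ i * W $$ (i, j) * q j) = (\<Sum>j<N. (\<Sum>i<N. r $ i * W $$ (i, j)) * q j)"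
    by (subst sum.swap) (simp add: sum_distrib_right)
  also have "\<dots> = (\<Sum>i<N. \<Sum>j<N. r $ i * W $$ (i, j) * q i)"
    using laplacian_left_kernel_balance[OF W r r_left]
    by (intro sum.cong) (auto simp: sum_distrib_left sum_distrib_right)
  finally show ?thesis by simp
qed

text \<open>A Poincare inequality on the graph, obtained from paths instead of a spectral gap: the
  squared difference across an arc, times its positive weight, is one summand of the disagreement,
  and a path from i to j adds up such arcs.\<close>

lemma ip_diff_le_disagreement:
  assumes W: "weighted_adjacency N W" and conn: "strongly_connected (adjacency_digraph N W)"
    and r_pos: "\<And>i. i < N \<Longrightarrow> 0 < r $ i"
  obtains K where "0 \<le> K"
    "\<And>e i j. (\<And>i. i < N \<Longrightarrow> e i \<in> carrier_vec n) \<Longrightarrow> i < N \<Longrightarrow> j < N \<Longrightarrow>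
      ip (e i - e j) (e i - e j) \<le> K * disagreement N W r e"
proof -
  let ?adm = "\<lambda>e :: nat \<Rightarrow> real vec. \<forall>i<N. e i \<in> carrier_vec n"
  have W0: "0 \<le> W $$ (i, j)" if "i < N" "j < N" for i j
    using W that unfolding weighted_adjacency_def by auto
  have term_nonneg: "0 \<le> r $ i * W $$ (i, j) * ip (e i - e j) (e i - e j)"
    if "?adm e" "i < N" "j < N" for e i j
    using that W0[OF that(2,3)] r_pos[OF that(2)] by (intro mult_nonneg_nonneg ip_nonneg) auto
  have term_le: "r $ i * W $$ (i, j) * ip (e i - e j) (e i - e j) \<le> disagreement N W r e"
    if "?adm e" "i < N" "j < N" for e i j
  proof -
    have "r $ i * W $$ (i, j) * ip (e i - e j) (e i - e j) \<le>
        (\<Sum>j<N. r $ i * W $$ (i, j) * ip (e i - e j) (e i - e j))"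
      using term_nonneg[OF that(1,2)] that(3)
      by (intro member_le_sum[of _ _ "\<lambda>j. r $ i * W $$ (i, j) * ip (e i - e j) (e i - e j)"]) auto
    also have "\<dots> \<le> disagreement N W r e"
      unfolding disagreement_def using term_nonneg[OF that(1)] that(2)
      by (intro member_le_sum[of _ _ "\<lambda>i. \<Sum>j<N. r $ i * W $$ (i, j) * ip (e i - e j) (e i - e j)"])
        (auto intro!: sum_nonneg)
    finally show ?thesis .
  qed
  have disag_nonneg: "0 \<le> disagreement N W r e" if "?adm e" for e
    unfolding disagreement_def using term_nonneg[OF that] by (intro sum_nonneg) auto
  \<comment> \<open>The constant is quantified before the vectors, since it must serve all times and
    trajectories.\<close>
  have ex: "\<exists>c\<ge>0. \<forall>e. ?adm e \<longrightarrow> ip (e i - e j) (e i - e j) \<le> c * disagreement N W r e"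
    if "i < N" "j < N" for i j
  proof -
    have "i \<rightarrow>\<^sup>*\<^bsub>adjacency_digraph N W\<^esub> j"
      using conn that unfolding strongly_connected_def by (simp add: adjacency_digraph_def)
    then show ?thesis
    unfolding reachable_def
    proof (induction rule: rtrancl_on_induct)
      case base
      have "ip (e i - e i) (e i - e i) = 0" if "?adm e" for e
        using that \<open>i < N\<close> by (simp add: minus_cancel_vec[of "e i" n])
      then show ?case by (intro exI[of _ 0]) auto
    next
      case (step j k)
      then obtain c where c: "0 \<le> c" "\<And>e. ?adm e \<Longrightarrow> ip (e i - e j) (e i - e j) \<le> c * disagreement N W r e"
        by auto
      from step(2) have jk: "j < N" "k < N" "0 < W $$ (k, j)"
        by (auto simp: arcs_ends_def arc_to_ends_def adjacency_digraph_def)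
      define a where "a = r $ k * W $$ (k, j)"
      have a: "0 < a" unfolding a_def using jk r_pos by simp
      \<comment> \<open>c accounts for the path so far, 1 / a for the new arc from j to k, whose
        weight is \<open>W $$ (k, j)\<close>; the squared triangle inequality doubles both.\<close>
      show ?case
      proof (intro exI[of _ "2 * c + 2 / a"] conjI allI impI)
        fix e assume e: "?adm e"
        have "ip (e j - e k) (e j - e k) \<le> disagreement N W r e / a"
          using term_le[OF e jk(2,1)] ip_minus_commute[of "e j" "e k"] e jk a unfolding a_def[symmetric]
          by (simp add: field_simps)
        moreover have "ip (e i - e k) (e i - e k) \<le> 2 * ip (e i - e j) (e i - e j) + 2 * ip (e j - e k) (e j - e k)"
          using e \<open>i < N\<close> jk by (intro ip_diff_diff_le) auto
        ultimately show "ip (e i - e k) (e i - e k) \<le> (2 * c + 2 / a) * disagreement N W r e"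
          using c(2)[OF e] by (simp add: algebra_simps)
      qed (use c a in auto)
    qed
  qed
  define c where "c i j = (SOME c. 0 \<le> c \<and> (\<forall>e. ?adm e \<longrightarrow> ip (e i - e j) (e i - e j) \<le> c * disagreement N W r e))"
    for i j
  have c: "0 \<le> c i j" "\<And>e. ?adm e \<Longrightarrow> ip (e i - e j) (e i - e j) \<le> c i j * disagreement N W r e"
    if "i < N" "j < N" for i j
    using someI_ex[OF ex[OF that]] unfolding c_def by auto
  define K where "K = (\<Sum>i<N. \<Sum>j<N. c i j)"
  show thesis
  proof (rule that[of K])
    show "0 \<le> K" unfolding K_def using c(1) by (intro sum_nonneg) auto
    fix e :: "nat \<Rightarrow> real vec" and i j
    assume e: "\<And>i. i < N \<Longrightarrow> e i \<in> carrier_vec n" and ij: "i < N" "j < N"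
    have "c i j \<le> (\<Sum>j<N. c i j)"
      using c(1)[OF ij(1)] ij by (intro member_le_sum[of _ _ "c i"]) auto
    also have "\<dots> \<le> K"
      unfolding K_def using c(1) ij
      by (intro member_le_sum[of _ _ "\<lambda>i. \<Sum>j<N. c i j"]) (auto intro!: sum_nonneg)
    finally have "c i j * disagreement N W r e \<le> K * disagreement N W r e"
      using disag_nonneg e by (intro mult_right_mono) auto
    then show "ip (e i - e j) (e i - e j) \<le> K * disagreement N W r e"
      using c(2)[OF ij, of e] e by simp
  qed
qed

end


section \<open>Derivatives of vector trajectories and exponential decay\<close>

lemma has_vec_derivative_cong:
  assumes "has_vec_derivative d f f'" "\<And>t. 0 \<le> t \<Longrightarrow> f' t = g' t"
  shows "has_vec_derivative d f g'"
  using assms unfolding has_vec_derivative_def by simp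

lemma has_vec_derivative_carrier:
  assumes "has_vec_derivative d f f'" "0 \<le> t"
  shows "f t \<in> carrier_vec d" "f' t \<in> carrier_vec d"
  using assms unfolding has_vec_derivative_def by auto

text \<open>Trajectories are known to have the right dimension only for t \<ge> 0, so component
  formulas for vector operations hold only there.\<close>

lemma has_real_derivative_on_nonneg_cong:
  fixes f g :: "real \<Rightarrow> real"
  assumes "(f has_real_derivative D) (at t within {0..})" "0 \<le> t"
    and "\<And>s. 0 \<le> s \<Longrightarrow> f s = g s"
  shows "(g has_real_derivative D) (at t within {0..})"
  using has_field_derivative_transform_within[OF assms(1), of 1 g] assms(2,3) by simp

lemma has_vec_derivative_diff:
  assumes f: "has_vec_derivative d f f'" and g: "has_vec_derivative d g g'"
  shows "has_vec_derivative d (\<lambda>t. f t - g t) (\<lambda>t. f' t - g' t)"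
  unfolding has_vec_derivative_def
proof (intro allI impI conjI)
  fix t :: real and k assume t: "0 \<le> t" and k: "k < d"
  note car = has_vec_derivative_carrier[OF f] has_vec_derivative_carrier[OF g]
  have "((\<lambda>s. f s $ k - g s $ k) has_real_derivative f' t $ k - g' t $ k) (at t within {0..})"
    using f g t k unfolding has_vec_derivative_def by (intro DERIV_diff) auto
  then have "((\<lambda>s. f s $ k - g s $ k) has_real_derivative (f' t - g' t) $ k) (at t within {0..})"
    using car[OF t] k by simp
  then show "((\<lambda>s. (f s - g s) $ k) has_real_derivative (f' t - g' t) $ k) (at t within {0..})"
  proof (rule has_real_derivative_on_nonneg_cong)
    show "f s $ k - g s $ k = (f s - g s) $ k" if "0 \<le> s" for s using car[OF that] k by simp
  qed (rule t)
qed (use has_vec_derivative_carrier[OF f] has_vec_derivative_carrier[OF g] in auto)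

lemma has_vec_derivative_mult_mat_vec:
  assumes f: "has_vec_derivative d f f'" and M: "M \<in> carrier_mat a d"
  shows "has_vec_derivative a (\<lambda>t. M *\<^sub>v f t) (\<lambda>t. M *\<^sub>v f' t)"
  unfolding has_vec_derivative_def
proof (intro allI impI conjI)
  fix t :: real and k assume t: "0 \<le> t" and k: "k < a"
  have expand: "(M *\<^sub>v v) $ k = (\<Sum>j<d. M $$ (k, j) * v $ j)" if "v \<in> carrier_vec d" for v
    using M k that by (simp add: scalar_prod_def atLeast0LessThan)
  note car = has_vec_derivative_carrier[OF f]
  have "((\<lambda>s. \<Sum>j<d. M $$ (k, j) * f s $ j) has_real_derivative (\<Sum>j<d. M $$ (k, j) * f' t $ j))
      (at t within {0..})"
    using f t unfolding has_vec_derivative_def by (intro DERIV_sum DERIV_cmult) auto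
  then have "((\<lambda>s. \<Sum>j<d. M $$ (k, j) * f s $ j) has_real_derivative (M *\<^sub>v f' t) $ k) (at t within {0..})"
    unfolding expand[OF car(2)[OF t]] .
  then show "((\<lambda>s. (M *\<^sub>v f s) $ k) has_real_derivative (M *\<^sub>v f' t) $ k) (at t within {0..})"
    by (rule has_real_derivative_on_nonneg_cong) (use t expand car in auto)
qed (use mult_mat_vec_carrier[OF M] has_vec_derivative_carrier[OF f] in auto)

lemma has_real_derivative_scalar_prod:
  assumes f: "has_vec_derivative d f f'" and g: "has_vec_derivative d g g'" and t: "0 \<le> t"
  shows "((\<lambda>s. f s \<bullet> g s) has_real_derivative f' t \<bullet> g t + f t \<bullet> g' t) (at t within {0..})"
proof -
  note carf = has_vec_derivative_carrier[OF f] and carg = has_vec_derivative_carrier[OF g]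
  have expand: "u \<bullet> v = (\<Sum>j<d. u $ j * v $ j)" if "v \<in> carrier_vec d" for u v :: "real vec"
    using that by (simp add: scalar_prod_def atLeast0LessThan)
  have "((\<lambda>s. \<Sum>j<d. f s $ j * g s $ j) has_real_derivative
      (\<Sum>j<d. f' t $ j * g t $ j + g' t $ j * f t $ j)) (at t within {0..})"
    using f g t unfolding has_vec_derivative_def by (intro DERIV_sum DERIV_mult) auto
  moreover have "(\<Sum>j<d. f' t $ j * g t $ j + g' t $ j * f t $ j) = f' t \<bullet> g t + f t \<bullet> g' t"
    using expand[OF carg(1)[OF t]] expand[OF carg(2)[OF t]] by (simp add: sum.distrib mult.commute)
  ultimately show ?thesis
    using has_real_derivative_on_nonneg_cong[OF _ t, of "\<lambda>s. \<Sum>j<d. f s $ j * g s $ j" _ "\<lambda>s. f s \<bullet> g s"]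
      expand[OF carg(1)] by simp
qed

text \<open>Integrating factor: exp (c t) V t does not increase. The derivative at 0 is one-sided,
  so the monotonicity criterion is used with derivatives inside the open interval and mere
  continuity at its ends.\<close>

lemma Gronwall_exp_decay:
  fixes V V' :: "real \<Rightarrow> real"
  assumes der: "\<And>t. 0 \<le> t \<Longrightarrow> (V has_real_derivative V' t) (at t within {0..})"
    and le: "\<And>t. 0 \<le> t \<Longrightarrow> V' t \<le> - c * V t" and t: "0 \<le> t"
  shows "V t \<le> exp (- c * t) * V 0"
proof (cases "t = 0")
  case False
  define \<phi> where "\<phi> s = exp (c * s) * V s" for s
  have d: "(\<phi> has_real_derivative exp (c * s) * (V' s + c * V s)) (at s within {0..})" if "0 \<le> s" for s
    unfolding \<phi>_def using der[OF that]
    by (auto intro!: derivative_eq_intros simp: algebra_simps)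
  have "\<phi> t \<le> \<phi> 0"
  proof (rule DERIV_nonpos_imp_decreasing_open[of 0 t \<phi>])
    show "0 \<le> t" by (rule t)
    show "\<exists>y. (\<phi> has_real_derivative y) (at s) \<and> y \<le> 0" if "0 < s" "s < t" for s
    proof (intro exI conjI)
      have "at s within {0..} = at s"
        using that by (intro at_within_nhd[of _ "{0<..}"]) auto
      then show "(\<phi> has_real_derivative exp (c * s) * (V' s + c * V s)) (at s)"
        using d[of s] that by simp
      show "exp (c * s) * (V' s + c * V s) \<le> 0"
        using le[of s] that by (intro mult_nonneg_nonpos) auto
    qed
    show "continuous_on {0..t} \<phi>"
    proof (rule continuous_on_subset)
      show "continuous_on {0..} \<phi>"
        unfolding continuous_on_eq_continuous_within using DERIV_continuous[OF d] by simp
    qed auto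
  qed
  then have "exp (- c * t) * (exp (c * t) * V t) \<le> exp (- c * t) * V 0"
    unfolding \<phi>_def by (intro mult_left_mono) auto
  then show ?thesis by (simp add: mult.assoc[symmetric] exp_add[symmetric])
qed simp

section \<open>Euclidean norms of stacked vectors and outputs\<close>

lemma euclid_norm_eq_sqrt: "euclid_norm v = sqrt (v \<bullet> v)"
  unfolding euclid_norm_def L2_set_def scalar_prod_def by (simp add: power2_eq_square atLeast0LessThan)

lemma scalar_prod_vec_of_list:
  "vec_of_list xs \<bullet> vec_of_list xs = (\<Sum>x\<leftarrow>xs. x * (x::real))"
  unfolding scalar_prod_def
  by (simp add: sum_list_sum_nth vec_of_list_index)

lemma scalar_prod_eq_sum_list: "v \<bullet> v = (\<Sum>x\<leftarrow>list_of_vec v. x * (x::real))"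
  using scalar_prod_vec_of_list[of "list_of_vec v"] by (simp add: vec_list)

lemma sum_list_concat_upt:
  "(\<Sum>x\<leftarrow>concat (map f [0..<N]). g x) = (\<Sum>i<N. \<Sum>x\<leftarrow>f i. (g x :: real))"
  by (induction N) auto

lemma scalar_prod_stack_vec: "stack_vec N v \<bullet> stack_vec N v = (\<Sum>i<N. v i \<bullet> v i)"
  unfolding stack_vec_def scalar_prod_vec_of_list sum_list_concat_upt
  by (simp add: scalar_prod_eq_sum_list[symmetric])

lemma scalar_prod_mult_mat_vec_eq_sum_list:
  "(A *\<^sub>v v) \<bullet> (A *\<^sub>v v) = (\<Sum>a\<leftarrow>rows A. (a \<bullet> v) * (a \<bullet> (v :: real vec)))"
  unfolding scalar_prod_def[of "A *\<^sub>v v"] by (simp add: sum_list_sum_nth)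

lemma stack_mat_carrier:
  "stack_mat n N C \<in> carrier_mat (length (concat (map (\<lambda>i. rows (C i)) [0..<N]))) n"
  unfolding stack_mat_def by simp

text \<open>This turns the surplus kappa |C v|^2 into local output energies, to which C_i e_i = 0
  can be applied.\<close>

lemma scalar_prod_stack_mat_mult_vec:
  assumes "\<And>i. i < N \<Longrightarrow> C i \<in> carrier_mat (m i) n"
  shows "(stack_mat n N C *\<^sub>v v) \<bullet> (stack_mat n N C *\<^sub>v v) = (\<Sum>i<N. (C i *\<^sub>v v) \<bullet> (C i *\<^sub>v v))"
proof -
  have "set (rows (C i)) \<subseteq> carrier_vec n" if "i < N" for i
    using rows_carrier[of "C i"] assms[OF that] by simp
  then have "set (concat (map (\<lambda>i. rows (C i)) [0..<N])) \<subseteq> carrier_vec n"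
    by (auto simp: subset_iff)
  then have "rows (stack_mat n N C) = concat (map (\<lambda>i. rows (C i)) [0..<N])"
    unfolding stack_mat_def by (rule rows_mat_of_rows)
  then show ?thesis
    unfolding scalar_prod_mult_mat_vec_eq_sum_list by (simp add: sum_list_concat_upt)
qed

section \<open>Error dynamics of the coupled observers\<close>

context inner_product_mat
begin

text \<open>\<open>K\<close> combines the size of each C_j relative to the inner product with the
  path constants of the graph. It does not depend on the errors, which allows one gain for all
  trajectories.\<close>

lemma observation_energy_le_disagreement:
  fixes C :: "nat \<Rightarrow> real mat"
  assumes C: "\<And>i. i < N \<Longrightarrow> C i \<in> carrier_mat (m i) n"
    and W: "weighted_adjacency N W" and conn: "strongly_connected (adjacency_digraph N W)"
    and r_pos: "\<And>i. i < N \<Longrightarrow> 0 < r $ i"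
  obtains K where "0 \<le> K"
    "\<And>e. (\<And>i. i < N \<Longrightarrow> e i \<in> carrier_vec n) \<Longrightarrow> (\<And>i. i < N \<Longrightarrow> C i *\<^sub>v e i = 0\<^sub>v (m i)) \<Longrightarrow>
      (\<Sum>i<N. \<Sum>j<N. (C j *\<^sub>v e i) \<bullet> (C j *\<^sub>v e i)) \<le> K * disagreement N W r e"
proof -
  obtain K2 where K2: "0 \<le> K2"
    "\<And>e i j. (\<And>i. i < N \<Longrightarrow> e i \<in> carrier_vec n) \<Longrightarrow> i < N \<Longrightarrow> j < N \<Longrightarrow>
      ip (e i - e j) (e i - e j) \<le> K2 * disagreement N W r e"
    using ip_diff_le_disagreement[where W = W and r = r and N = N] W conn r_pos by metis
  have "\<exists>K\<ge>0. \<forall>w\<in>carrier_vec n. (C j *\<^sub>v w) \<bullet> (C j *\<^sub>v w) \<le> K * ip w w" if j: "j < N" for j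
  proof -
    have "(C j)\<^sup>T * C j \<in> carrier_mat n n" using C[OF j] by simp
    then obtain K where "0 \<le> K" "\<And>w. w \<in> carrier_vec n \<Longrightarrow> w \<bullet> (((C j)\<^sup>T * C j) *\<^sub>v w) \<le> K * ip w w"
      by (rule quadratic_form_le_ip) blast
    then show ?thesis using transpose_mult_self_form[OF C[OF j]] by auto
  qed
  then obtain k where k: "\<And>j. j < N \<Longrightarrow> 0 \<le> k j"
    "\<And>j w. j < N \<Longrightarrow> w \<in> carrier_vec n \<Longrightarrow> (C j *\<^sub>v w) \<bullet> (C j *\<^sub>v w) \<le> k j * ip w w"
    by metis
  define K where "K = (\<Sum>i<N. \<Sum>j<N. k j * K2)"
  show thesis
  proof (rule that[of K])
    show "0 \<le> K" unfolding K_def using k(1) K2(1) by (intro sum_nonneg mult_nonneg_nonneg) auto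
    fix e :: "nat \<Rightarrow> real vec"
    assume e: "\<And>i. i < N \<Longrightarrow> e i \<in> carrier_vec n" and Ce: "\<And>i. i < N \<Longrightarrow> C i *\<^sub>v e i = 0\<^sub>v (m i)"
    have "(C j *\<^sub>v e i) \<bullet> (C j *\<^sub>v e i) \<le> k j * K2 * disagreement N W r e" if "i < N" "j < N" for i j
    proof -
      have "C j *\<^sub>v (e i - e j) = C j *\<^sub>v e i"
        using mult_minus_distrib_mat_vec[OF C[OF that(2)] e[OF that(1)] e[OF that(2)]] Ce[OF that(2)]
          mult_mat_vec_carrier[OF C[OF that(2)] e[OF that(1)]] by (auto intro!: eq_vecI)
      then have "(C j *\<^sub>v e i) \<bullet> (C j *\<^sub>v e i) \<le> k j * ip (e i - e j) (e i - e j)"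
        using k(2)[OF that(2), of "e i - e j"] e that by simp
      also have "\<dots> \<le> k j * (K2 * disagreement N W r e)"
        using K2(2)[OF e that] k(1)[OF that(2)] by (intro mult_left_mono) auto
      finally show ?thesis by (simp add: mult.assoc)
    qed
    then have "(\<Sum>i<N. \<Sum>j<N. (C j *\<^sub>v e i) \<bullet> (C j *\<^sub>v e i)) \<le> (\<Sum>i<N. \<Sum>j<N. k j * K2 * disagreement N W r e)"
      by (intro sum_mono) auto
    then show "(\<Sum>i<N. \<Sum>j<N. (C j *\<^sub>v e i) \<bullet> (C j *\<^sub>v e i)) \<le> K * disagreement N W r e"
      unfolding K_def by (simp add: sum_distrib_right del: sum_constant)
  qed
qed

text \<open>The matrices follow from the rule that z_i should track S_i x: apply S_i to A xhat_i +
  gamma r_i sum_j a_ij (xhat_j - xhat_i) and insert xhat_i = P_i z_i + Q_i y_i. This gives N_i = S_i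
  A P_i, L_i = S_i A Q_i and M_i = S_i.\<close>

lemma observer_error_form_decay:
  fixes A :: "real mat" and C P S Q :: "nat \<Rightarrow> real mat" and d m :: "nat \<Rightarrow> nat"
  assumes A: "A \<in> carrier_mat n n"
    and C: "\<And>i. i < N \<Longrightarrow> C i \<in> carrier_mat (m i) n"
    and P: "\<And>i. i < N \<Longrightarrow> P i \<in> carrier_mat n (d i)"
    and S: "\<And>i. i < N \<Longrightarrow> S i \<in> carrier_mat (d i) n"
    and Q: "\<And>i. i < N \<Longrightarrow> Q i \<in> carrier_mat n (m i)"
    and CP: "\<And>i u. i < N \<Longrightarrow> u \<in> carrier_vec (d i) \<Longrightarrow> C i *\<^sub>v (P i *\<^sub>v u) = 0\<^sub>v (m i)"
    and split: "\<And>i x. i < N \<Longrightarrow> x \<in> carrier_vec n \<Longrightarrow> P i *\<^sub>v (S i *\<^sub>v x) + Q i *\<^sub>v (C i *\<^sub>v x) = x"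
    and proj: "\<And>i u w. i < N \<Longrightarrow> u \<in> carrier_vec (d i) \<Longrightarrow> w \<in> carrier_vec n \<Longrightarrow>
      ip (P i *\<^sub>v u) (P i *\<^sub>v (S i *\<^sub>v w)) = ip (P i *\<^sub>v u) w"
    and W: "W \<in> carrier_mat N N" and r: "r \<in> carrier_vec N"
    and r_left: "mat_of_row r * laplacian N W = 0\<^sub>m 1 N"
    and stab: "\<And>v. v \<in> carrier_vec n \<Longrightarrow>
      ip v (A *\<^sub>v v) \<le> - \<sigma> * ip v v + \<kappa> * (\<Sum>j<N. (C j *\<^sub>v v) \<bullet> (C j *\<^sub>v v))"
    and \<kappa>: "0 \<le> \<kappa>"
    and K: "\<And>e. (\<And>i. i < N \<Longrightarrow> e i \<in> carrier_vec n) \<Longrightarrow> (\<And>i. i < N \<Longrightarrow> C i *\<^sub>v e i = 0\<^sub>v (m i)) \<Longrightarrow>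
      (\<Sum>i<N. \<Sum>j<N. (C j *\<^sub>v e i) \<bullet> (C j *\<^sub>v e i)) \<le> K * disagreement N W r e"
    and traj: "observer_trajectory n N A C W r d (2 * \<kappa> * K) (\<lambda>i. S i * (A * P i)) (\<lambda>i. S i * (A * Q i)) S P Q x z"
    and t: "0 \<le> t"
  defines "e \<equiv> \<lambda>i t. estimate C P Q x z i t - x t"
  shows "(\<Sum>i<N. ip (e i t) (e i t)) \<le> exp (- (2 * \<sigma>) * t) * (\<Sum>i<N. ip (e i 0) (e i 0))"
    and "\<And>i. i < N \<Longrightarrow> e i t \<in> carrier_vec n"
proof -
  define \<gamma> where "\<gamma> = 2 * \<kappa> * K"
  define F where "F i t = finsum_vec TYPE(real) n
    (\<lambda>j. W $$ (i, j) \<cdot>\<^sub>v (estimate C P Q x z j t - estimate C P Q x z i t)) {..<N}" for i t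
  define zd where "zd i t = (S i * (A * P i)) *\<^sub>v z i t + (S i * (A * Q i)) *\<^sub>v (C i *\<^sub>v x t)
    + (\<gamma> * r $ i) \<cdot>\<^sub>v (S i *\<^sub>v F i t)" for i t
  have x: "has_vec_derivative n x (\<lambda>t. A *\<^sub>v x t)"
    and z: "\<And>i. i < N \<Longrightarrow> has_vec_derivative (d i) (z i) (zd i)"
    using traj unfolding observer_trajectory_def zd_def F_def \<gamma>_def by auto
  have xc: "x t \<in> carrier_vec n" if "0 \<le> t" for t using has_vec_derivative_carrier(1)[OF x that] .
  have zc: "z i t \<in> carrier_vec (d i)" if "i < N" "0 \<le> t" for i t
    using has_vec_derivative_carrier(1)[OF z[OF that(1)] that(2)] .
  note PC = mult_mat_vec_carrier[OF P] and SC = mult_mat_vec_carrier[OF S]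
    and QC = mult_mat_vec_carrier[OF Q] and CC = mult_mat_vec_carrier[OF C]
    and AC = mult_mat_vec_carrier[OF A]
  have est: "estimate C P Q x z i t \<in> carrier_vec n" if "i < N" "0 \<le> t" for i t
    unfolding estimate_def using that PC zc QC CC xc by auto
  have Fc: "F i t \<in> carrier_vec n" if "i < N" "0 \<le> t" for i t
    unfolding F_def by (rule finsum_vec_closed) (use est that in auto)
  have ec: "e i t \<in> carrier_vec n" if "i < N" "0 \<le> t" for i t
    unfolding e_def using est xc that by simp
  show "\<And>i. i < N \<Longrightarrow> e i t \<in> carrier_vec n" using ec t by blast
  \<comment> \<open>The deviation of z_i from its target. As P_i S_i + Q_i C_i = I, the measured
    part cancels in the error and e_i = P_i u_i.\<close>
  define u where "u i t = z i t - S i *\<^sub>v x t" for i t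
  have uc: "u i t \<in> carrier_vec (d i)" if "i < N" "0 \<le> t" for i t
    unfolding u_def using zc SC xc that by simp
  have e_eq: "e i t = P i *\<^sub>v u i t" if i: "i < N" and t: "0 \<le> t" for i t
  proof -
    define a b c where "a = P i *\<^sub>v z i t" and "b = Q i *\<^sub>v (C i *\<^sub>v x t)" and "c = P i *\<^sub>v (S i *\<^sub>v x t)"
    have "a \<in> carrier_vec n" "b \<in> carrier_vec n" "c \<in> carrier_vec n"
      unfolding a_def b_def c_def using i t PC zc QC CC SC xc by auto
    then have "(a + b) - (c + b) = a - c" by (intro eq_vecI) auto
    moreover have "c + b = x t" unfolding b_def c_def using split[OF i xc[OF t]] .
    moreover have "a - c = P i *\<^sub>v u i t"
      unfolding a_def c_def u_def using mult_minus_distrib_mat_vec[OF P[OF i] zc[OF i t] SC[OF i xc[OF t]]] by simp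
    ultimately show ?thesis unfolding e_def estimate_def a_def b_def by simp
  qed
  have Ce: "C i *\<^sub>v e i t = 0\<^sub>v (m i)" if "i < N" "0 \<le> t" for i t
    using CP e_eq uc that by simp
  define ud where "ud i t = S i *\<^sub>v (A *\<^sub>v e i t + (\<gamma> * r $ i) \<cdot>\<^sub>v F i t)" for i t
  have u: "has_vec_derivative (d i) (u i) (ud i)" if i: "i < N" for i
  proof (rule has_vec_derivative_cong)
    show "has_vec_derivative (d i) (u i) (\<lambda>t. zd i t - S i *\<^sub>v (A *\<^sub>v x t))"
      unfolding u_def
      by (rule has_vec_derivative_diff[OF z[OF i] has_vec_derivative_mult_mat_vec[OF x S[OF i]]])
    fix t :: real assume t: "0 \<le> t"
    define a b where "a = P i *\<^sub>v z i t" and "b = Q i *\<^sub>v (C i *\<^sub>v x t)"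
    have ab: "a \<in> carrier_vec n" "b \<in> carrier_vec n"
      unfolding a_def b_def using i t PC zc QC CC xc by auto
    have "(S i * (A * P i)) *\<^sub>v z i t = S i *\<^sub>v (A *\<^sub>v a)"
      unfolding a_def using S[OF i] A P[OF i] zc[OF i t]
        assoc_mult_mat_vec[OF S[OF i] mult_carrier_mat[OF A P[OF i]] zc[OF i t]]
        assoc_mult_mat_vec[OF A P[OF i] zc[OF i t]] by simp
    moreover have "(S i * (A * Q i)) *\<^sub>v (C i *\<^sub>v x t) = S i *\<^sub>v (A *\<^sub>v b)"
      unfolding b_def using
        assoc_mult_mat_vec[OF S[OF i] mult_carrier_mat[OF A Q[OF i]] CC[OF i xc[OF t]]]
        assoc_mult_mat_vec[OF A Q[OF i] CC[OF i xc[OF t]]] by simp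
    moreover have "ud i t = ((S i *\<^sub>v (A *\<^sub>v a) + S i *\<^sub>v (A *\<^sub>v b)) - S i *\<^sub>v (A *\<^sub>v x t)) + (\<gamma> * r $ i) \<cdot>\<^sub>v (S i *\<^sub>v F i t)"
    proof -
      have eq: "e i t = (a + b) - x t" unfolding e_def estimate_def a_def b_def ..
      have "A *\<^sub>v e i t = (A *\<^sub>v a + A *\<^sub>v b) - A *\<^sub>v x t"
        unfolding eq using ab xc[OF t] by (simp add: mult_minus_distrib_mat_vec[OF A] mult_add_distrib_mat_vec[OF A])
      then show ?thesis
        unfolding ud_def using AC[OF ab(1)] AC[OF ab(2)] AC[OF xc[OF t]] Fc[OF i t]
        by (simp add: mult_minus_distrib_mat_vec[OF S[OF i]] mult_add_distrib_mat_vec[OF S[OF i]] mult_mat_vec[OF S[OF i]])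
    qed
    moreover have "(\<alpha> + \<beta>) + \<delta> - \<epsilon> = ((\<alpha> + \<beta>) - \<epsilon>) + \<delta>"
      if "\<alpha> \<in> carrier_vec (d i)" "\<beta> \<in> carrier_vec (d i)" "\<delta> \<in> carrier_vec (d i)" "\<epsilon> \<in> carrier_vec (d i)"
      for \<alpha> \<beta> \<delta> \<epsilon> :: "real vec"
      using that by (intro eq_vecI) auto
    ultimately show "zd i t - S i *\<^sub>v (A *\<^sub>v x t) = ud i t"
      unfolding zd_def using SC[OF i AC[OF ab(1)]] SC[OF i AC[OF ab(2)]] SC[OF i AC[OF xc[OF t]]] SC[OF i Fc[OF i t]]
      by simp
  qed
  \<comment> \<open>Written with u_i, whose derivative is at hand; P_i u_i agrees with e_i for t
    \<ge> 0.\<close>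
  define V where "V t = (\<Sum>i<N. ip (P i *\<^sub>v u i t) (P i *\<^sub>v u i t))" for t
  define V' where "V' t = (\<Sum>i<N. 2 * ip (P i *\<^sub>v u i t) (P i *\<^sub>v ud i t))" for t
  have V: "(V has_real_derivative V' t) (at t within {0..})" if t: "0 \<le> t" for t
    unfolding V_def V'_def
  proof (rule DERIV_sum)
    fix i assume "i \<in> {..<N}"
    then have i: "i < N" by simp
    have Pu: "has_vec_derivative n (\<lambda>t. P i *\<^sub>v u i t) (\<lambda>t. P i *\<^sub>v ud i t)"
      by (rule has_vec_derivative_mult_mat_vec[OF u[OF i] P[OF i]])
    have "((\<lambda>t. ip (P i *\<^sub>v u i t) (P i *\<^sub>v u i t)) has_real_derivative
        ip (P i *\<^sub>v ud i t) (P i *\<^sub>v u i t) + ip (P i *\<^sub>v u i t) (P i *\<^sub>v ud i t)) (at t within {0..})"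
      unfolding ip_def
      by (rule has_real_derivative_scalar_prod[OF Pu has_vec_derivative_mult_mat_vec[OF Pu G] t])
    then show "((\<lambda>t. ip (P i *\<^sub>v u i t) (P i *\<^sub>v u i t)) has_real_derivative
        2 * ip (P i *\<^sub>v u i t) (P i *\<^sub>v ud i t)) (at t within {0..})"
      using ip_commute has_vec_derivative_carrier[OF Pu t] by simp
  qed
  have V'_le: "V' t \<le> - (2 * \<sigma>) * V t" if t: "0 \<le> t" for t
  proof -
    \<comment> \<open>The projection P_i S_i in front of the drift disappears because it is paired
      with e_i = P_i u_i, which lies in its range.\<close>
    have "ip (P i *\<^sub>v u i t) (P i *\<^sub>v ud i t) = ip (e i t) (A *\<^sub>v e i t) + \<gamma> * (r $ i * ip (e i t) (F i t))"
      if i: "i < N" for i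
      using proj[OF i uc[OF i t], of "A *\<^sub>v e i t + (\<gamma> * r $ i) \<cdot>\<^sub>v F i t"] ec[OF i t] AC[OF ec[OF i t]] Fc[OF i t]
      unfolding ud_def e_eq[OF i t, symmetric] by (simp add: ip_linear_simps)
    then have "V' t = 2 * (\<Sum>i<N. ip (e i t) (A *\<^sub>v e i t)) + 2 * \<gamma> * (\<Sum>i<N. r $ i * ip (e i t) (F i t))"
      unfolding V'_def by (simp add: sum.distrib sum_distrib_left algebra_simps)
    also have "(\<Sum>i<N. r $ i * ip (e i t) (F i t)) =
        (\<Sum>i<N. r $ i * ip (e i t) (finsum_vec TYPE(real) n (\<lambda>j. W $$ (i, j) \<cdot>\<^sub>v (e j t - e i t)) {..<N}))"
    proof (rule sum.cong)
      fix i assume "i \<in> {..<N}"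
      then have i: "i < N" by simp
      have "estimate C P Q x z j t - estimate C P Q x z i t = e j t - e i t" if "j < N" for j
        unfolding e_def using est[OF i t] est[OF that t] xc[OF t] by (intro eq_vecI) auto
      then show "r $ i * ip (e i t) (F i t) =
          r $ i * ip (e i t) (finsum_vec TYPE(real) n (\<lambda>j. W $$ (i, j) \<cdot>\<^sub>v (e j t - e i t)) {..<N})"
        unfolding F_def using ec est i t
        by (subst (1 2) ip_finsum_vec) auto
    qed simp
    also have "\<dots> = - (disagreement N W r (\<lambda>i. e i t) / 2)"
      using coupling_eq_disagreement[OF W r r_left, of "\<lambda>i. e i t"] ec t by blast
    finally have "V' t = 2 * (\<Sum>i<N. ip (e i t) (A *\<^sub>v e i t)) - \<gamma> * disagreement N W r (\<lambda>i. e i t)"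
      by simp
    also have "(\<Sum>i<N. ip (e i t) (A *\<^sub>v e i t)) \<le>
        (\<Sum>i<N. - \<sigma> * ip (e i t) (e i t) + \<kappa> * (\<Sum>j<N. (C j *\<^sub>v e i t) \<bullet> (C j *\<^sub>v e i t)))"
      using stab ec t by (intro sum_mono) auto
    also have "\<dots> = - \<sigma> * V t + \<kappa> * (\<Sum>i<N. \<Sum>j<N. (C j *\<^sub>v e i t) \<bullet> (C j *\<^sub>v e i t))"
      unfolding V_def using e_eq t by (simp add: sum.distrib sum_distrib_left sum_negf sum_subtractf)
    also have "\<kappa> * (\<Sum>i<N. \<Sum>j<N. (C j *\<^sub>v e i t) \<bullet> (C j *\<^sub>v e i t)) \<le> \<kappa> * (K * disagreement N W r (\<lambda>i. e i t))"
      using K[of "\<lambda>i. e i t"] ec Ce t \<kappa> by (intro mult_left_mono) auto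
    \<comment> \<open>The value 2 kappa K of gamma makes the two disagreement terms cancel
      exactly.\<close>
    finally show ?thesis unfolding \<gamma>_def by (simp add: algebra_simps)
  qed
  have "V s = (\<Sum>i<N. ip (e i s) (e i s))" if "0 \<le> s" for s
    unfolding V_def using e_eq that by simp
  then show "(\<Sum>i<N. ip (e i t) (e i t)) \<le> exp (- (2 * \<sigma>) * t) * (\<Sum>i<N. ip (e i 0) (e i 0))"
    using Gronwall_exp_decay[OF V V'_le t] t by simp
qed

end


section \<open>Assembling the observer\<close>

lemma observable_stackD:
  assumes A: "A \<in> carrier_mat n n" and C: "C \<in> carrier_mat l n" and obs: "observable n C A"
    and w: "w \<in> carrier_vec n" and ker: "\<And>k. k < n \<Longrightarrow> C *\<^sub>v ((A ^\<^sub>m k) *\<^sub>v w) = 0\<^sub>v l"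
  shows "w = 0\<^sub>v n"
proof -
  have "w \<in> mat_kernel (C * (A ^\<^sub>m k))" if "k < n" for k
  proof (rule mat_kernelI[OF _ w])
    show "C * (A ^\<^sub>m k) \<in> carrier_mat l n" using C A by simp
    show "(C * (A ^\<^sub>m k)) *\<^sub>v w = 0\<^sub>v l"
      using assoc_mult_mat_vec[OF C pow_carrier_mat[OF A] w] ker[OF that] by simp
  qed
  then have "w \<in> carrier_vec n \<inter> (\<Inter>k\<in>{..<n}. mat_kernel (C * (A ^\<^sub>m k)))" using w by blast
  then show ?thesis using obs unfolding observable_def by blast
qed

theorem theorem2:
  fixes n N :: nat and m p :: "nat \<Rightarrow> nat"
    and A :: "real mat" and C :: "nat \<Rightarrow> real mat"
    and W :: "real mat" and r :: "real Matrix.vec" and \<alpha> :: real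
  assumes A: "A \<in> carrier_mat n n"
    and C: "\<And>i. i < N \<Longrightarrow> C i \<in> carrier_mat (m i) n"
    and p: "\<And>i. i < N \<Longrightarrow> p i = vec_space.rank (m i) (C i)"
    and obs: "observable n (stack_mat n N C) A"
    and W: "weighted_adjacency N W"
    and conn: "strongly_connected (adjacency_digraph N W)"
    and r: "r \<in> carrier_vec N"
    and r_pos: "\<And>i. i < N \<Longrightarrow> 0 < r $ i"
    and r_left: "mat_of_row r * laplacian N W = 0\<^sub>m 1 N"
    and r_sum: "r \<bullet> ones_vec N = real N"
    and \<alpha>: "0 \<le> \<alpha>"
  shows "\<exists>(\<gamma>::real) Nm L M P Q.
    (\<forall>i<N. Nm i \<in> carrier_mat (n - p i) (n - p i) \<and>
           L i \<in> carrier_mat (n - p i) (m i) \<and>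
           M i \<in> carrier_mat (n - p i) n \<and>
           P i \<in> carrier_mat n (n - p i) \<and>
           Q i \<in> carrier_mat n (m i)) \<and>
    (\<Sum>i<N. dim_row (Nm i)) + (\<Sum>i<N. p i) = N * n \<and>
    achieves_omniscience n N A C W r (\<lambda>i. n - p i) \<gamma> Nm L M P Q \<and>
    error_convergence_rate n N A C W r (\<lambda>i. n - p i) \<gamma> Nm L M P Q \<alpha>"
proof -
  define d where "d i = n - p i" for i
  \<comment> \<open>One more than alpha, so that the errors tend to 0 also when alpha = 0.\<close>
  define \<sigma> where "\<sigma> = \<alpha> + 1"
  have \<sigma>: "0 \<le> \<sigma>" unfolding \<sigma>_def using \<alpha> by simp
  have WN: "W \<in> carrier_mat N N" using W unfolding weighted_adjacency_def by blast
  obtain G \<kappa> where G: "inner_product_mat n G" and \<kappa>: "0 \<le> \<kappa>"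
    and stab: "\<And>v. v \<in> carrier_vec n \<Longrightarrow> v \<bullet> (G *\<^sub>v (A *\<^sub>v v)) \<le>
      - \<sigma> * (v \<bullet> (G *\<^sub>v v)) + \<kappa> * ((stack_mat n N C *\<^sub>v v) \<bullet> (stack_mat n N C *\<^sub>v v))"
    using observable_imp_stabilizing_form[OF A stack_mat_carrier observable_stackD[OF A stack_mat_carrier obs] \<sigma>]
    by blast
  interpret inner_product_mat n G by (rule G)
  obtain K where K: "0 \<le> K"
    "\<And>e. (\<And>i. i < N \<Longrightarrow> e i \<in> carrier_vec n) \<Longrightarrow> (\<And>i. i < N \<Longrightarrow> C i *\<^sub>v e i = 0\<^sub>v (m i)) \<Longrightarrow>
      (\<Sum>i<N. \<Sum>j<N. (C j *\<^sub>v e i) \<bullet> (C j *\<^sub>v e i)) \<le> K * disagreement N W r e"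
  proof (rule observation_energy_le_disagreement[of N C m W r])
    show "C i \<in> carrier_mat (m i) n" if "i < N" for i using C[OF that] .
    show "0 < r $ i" if "i < N" for i using r_pos[OF that] .
  qed (use W conn in auto)
  \<comment> \<open>Bundled into one predicate so that a single choice over the nodes yields the
    three families together.\<close>
  define splits where "splits i P S Q \<longleftrightarrow>
    P \<in> carrier_mat n (d i) \<and> S \<in> carrier_mat (d i) n \<and> Q \<in> carrier_mat n (m i) \<and>
    (\<forall>u\<in>carrier_vec (d i). C i *\<^sub>v (P *\<^sub>v u) = 0\<^sub>v (m i)) \<and>
    (\<forall>x\<in>carrier_vec n. P *\<^sub>v (S *\<^sub>v x) + Q *\<^sub>v (C i *\<^sub>v x) = x) \<and>
    (\<forall>u\<in>carrier_vec (d i). \<forall>w\<in>carrier_vec n. ip (P *\<^sub>v u) (P *\<^sub>v (S *\<^sub>v w)) = ip (P *\<^sub>v u) w)" for i P S Q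
  have "\<exists>P S Q. splits i P S Q" if i: "i < N" for i
  proof -
    have "n - vec_space.rank (m i) (C i) = d i" unfolding d_def p[OF i] ..
    from orthogonal_splitting[OF C[OF i], unfolded this] obtain P S Q where
      "P \<in> carrier_mat n (d i)" "S \<in> carrier_mat (d i) n" "Q \<in> carrier_mat n (m i)"
      "\<And>u. u \<in> carrier_vec (d i) \<Longrightarrow> C i *\<^sub>v (P *\<^sub>v u) = 0\<^sub>v (m i)"
      "\<And>x. x \<in> carrier_vec n \<Longrightarrow> P *\<^sub>v (S *\<^sub>v x) + Q *\<^sub>v (C i *\<^sub>v x) = x"
      "\<And>u w. u \<in> carrier_vec (d i) \<Longrightarrow> w \<in> carrier_vec n \<Longrightarrow>
        ip (P *\<^sub>v u) (P *\<^sub>v (S *\<^sub>v w)) = ip (P *\<^sub>v u) w"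
      by blast
    then have "splits i P S Q" unfolding splits_def by blast
    then show ?thesis by blast
  qed
  then obtain P S Q where PSQ: "\<And>i. i < N \<Longrightarrow> splits i (P i) (S i) (Q i)" by metis
  have P: "P i \<in> carrier_mat n (d i)" and S: "S i \<in> carrier_mat (d i) n" and Q: "Q i \<in> carrier_mat n (m i)"
    if "i < N" for i
    using PSQ[OF that] unfolding splits_def by simp_all
  have PSQ_props:
    "i < N \<Longrightarrow> u \<in> carrier_vec (d i) \<Longrightarrow> C i *\<^sub>v (P i *\<^sub>v u) = 0\<^sub>v (m i)"
    "i < N \<Longrightarrow> x \<in> carrier_vec n \<Longrightarrow> P i *\<^sub>v (S i *\<^sub>v x) + Q i *\<^sub>v (C i *\<^sub>v x) = x"
    "i < N \<Longrightarrow> u \<in> carrier_vec (d i) \<Longrightarrow> w \<in> carrier_vec n \<Longrightarrow>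
      ip (P i *\<^sub>v u) (P i *\<^sub>v (S i *\<^sub>v w)) = ip (P i *\<^sub>v u) w" for i u x w
    using PSQ[of i] unfolding splits_def by simp_all
  define Nm L where "Nm i = S i * (A * P i)" and "L i = S i * (A * Q i)" for i
  let ?traj = "observer_trajectory n N A C W r d (2 * \<kappa> * K) Nm L S P Q"
  have stab': "ip v (A *\<^sub>v v) \<le> - \<sigma> * ip v v + \<kappa> * (\<Sum>j<N. (C j *\<^sub>v v) \<bullet> (C j *\<^sub>v v))"
    if "v \<in> carrier_vec n" for v
    using stab[OF that] scalar_prod_stack_mat_mult_vec[OF C] unfolding ip_def by simp
  define e where "e x z i t = estimate C P Q x z i t - x t" for x z i t
  have observer: "(\<Sum>i<N. ip (e x z i t) (e x z i t)) \<le> exp (- (2 * \<sigma>) * t) * (\<Sum>i<N. ip (e x z i 0) (e x z i 0)) \<and>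
      (\<forall>i<N. e x z i t \<in> carrier_vec n)"
    if traj: "?traj x z" and t: "0 \<le> t" for x z t
  proof -
    note tr = traj[unfolded Nm_def[abs_def] L_def[abs_def]]
    note * = observer_error_form_decay[where C = C and m = m and N = N and P = P and d = d and S = S and Q = Q,
        OF A C P S Q PSQ_props WN r r_left stab' \<kappa> K(2) tr t, folded e_def]
    show ?thesis using * by blast
  qed
  note decay = observer[THEN conjunct1]
    and e_carrier = observer[THEN conjunct2, rule_format]
  obtain c where c: "0 \<le> c" "\<And>w. w \<in> carrier_vec n \<Longrightarrow> w \<bullet> w \<le> c * ip w w"
    using norm_sq_le_ip by blast
  obtain b where b: "0 \<le> b" "\<And>w. w \<in> carrier_vec n \<Longrightarrow> ip w w \<le> b * (w \<bullet> w)"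
    using quadratic_form_le_norm_sq[OF G] unfolding ip_def by blast
  define E where "E x z t = euclid_norm (observer_error N C P Q x z t)" for x z t
  have E: "E x z t = sqrt (\<Sum>i<N. e x z i t \<bullet> e x z i t)" for x z t
    unfolding E_def observer_error_def euclid_norm_eq_sqrt scalar_prod_stack_vec e_def ..
  \<comment> \<open>sqrt (c b) is the cost of passing from the Euclidean norm to that of
    \<open>G\<close> and back. Adding 1 keeps the constant positive, as the definition of the rate
    demands, even if c b = 0.\<close>
  define k where "k = sqrt (c * b) + 1"
  have k: "0 < k" unfolding k_def using c b by (simp add: add_nonneg_pos)
  have E_nonneg: "0 \<le> E x z t" for x z t
    unfolding E using scalar_prod_self_nonneg by (simp add: sum_nonneg)
  \<comment> \<open>The decaying form is quadratic in the errors, so its rate 2 sigma becomes sigma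
    after taking roots.\<close>
  have E_decay: "E x z t \<le> k * exp (- \<sigma> * t) * E x z 0" if tr: "?traj x z" and t: "0 \<le> t" for x z t
  proof -
    have "(\<Sum>i<N. e x z i t \<bullet> e x z i t) \<le> (\<Sum>i<N. c * ip (e x z i t) (e x z i t))"
      using c(2) e_carrier[OF tr t] by (intro sum_mono) auto
    also have "\<dots> = c * (\<Sum>i<N. ip (e x z i t) (e x z i t))" by (simp add: sum_distrib_left)
    also have "\<dots> \<le> c * (exp (- (2 * \<sigma>) * t) * (\<Sum>i<N. ip (e x z i 0) (e x z i 0)))"
      using decay[OF tr t] c(1) by (rule mult_left_mono)
    also have "\<dots> \<le> c * (exp (- (2 * \<sigma>) * t) * (\<Sum>i<N. b * (e x z i 0 \<bullet> e x z i 0)))"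
      using c(1) b(2) e_carrier[OF tr order_refl] by (intro mult_left_mono sum_mono) auto
    also have "\<dots> = (c * b) * ((exp (- \<sigma> * t))\<^sup>2 * (\<Sum>i<N. e x z i 0 \<bullet> e x z i 0))"
      by (simp add: sum_distrib_left exp_double[symmetric] mult_ac)
    finally have "E x z t \<le> sqrt ((c * b) * ((exp (- \<sigma> * t))\<^sup>2 * (\<Sum>i<N. e x z i 0 \<bullet> e x z i 0)))"
      unfolding E by (rule real_sqrt_le_mono)
    also have "\<dots> = sqrt (c * b) * (exp (- \<sigma> * t) * E x z 0)"
      unfolding E by (simp only: real_sqrt_mult real_sqrt_abs abs_exp_cancel)
    also have "\<dots> \<le> k * (exp (- \<sigma> * t) * E x z 0)"
      unfolding k_def using E_nonneg by (intro mult_right_mono mult_nonneg_nonneg) auto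
    finally show ?thesis by (simp add: mult.assoc)
  qed
  show ?thesis
  proof (intro exI conjI)
    show "\<forall>i<N. Nm i \<in> carrier_mat (n - p i) (n - p i) \<and> L i \<in> carrier_mat (n - p i) (m i) \<and>
        S i \<in> carrier_mat (n - p i) n \<and> P i \<in> carrier_mat n (n - p i) \<and> Q i \<in> carrier_mat n (m i)"
      unfolding Nm_def L_def d_def[symmetric]
      using P S Q mult_carrier_mat[OF S mult_carrier_mat[OF A P]] mult_carrier_mat[OF S mult_carrier_mat[OF A Q]]
      by blast
    \<comment> \<open>This makes the truncated subtraction \<open>n - p i\<close> exact, on which
      the dimension count depends.\<close>
    have "p i \<le> n" if "i < N" for i
      using rank_plus_kernel_dim[OF C[OF that]] p[OF that] by simp
    then have "dim_row (Nm i) + p i = n" if "i < N" for i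
      using carrier_matD(1)[OF S[OF that]] that unfolding Nm_def d_def by simp
    then have "(\<Sum>i<N. dim_row (Nm i)) + (\<Sum>i<N. p i) = (\<Sum>i<N. n)"
      unfolding sum.distrib[symmetric] by (intro sum.cong) auto
    then show "(\<Sum>i<N. dim_row (Nm i)) + (\<Sum>i<N. p i) = N * n" by simp
    show "achieves_omniscience n N A C W r (\<lambda>i. n - p i) (2 * \<kappa> * K) Nm L S P Q"
      unfolding achieves_omniscience_def d_def[symmetric]
    proof (intro allI impI)
      fix x z i assume tr: "?traj x z" and i: "i < N"
      have le: "euclid_norm (estimate C P Q x z i t - x t) \<le> E x z t" for t
        unfolding E euclid_norm_eq_sqrt e_def[symmetric] using i scalar_prod_self_nonneg
        by (intro real_sqrt_le_mono member_le_sum[of _ _ "\<lambda>i. e x z i t \<bullet> e x z i t"]) auto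
      have "((\<lambda>t. exp (- (\<sigma> * t))) \<longlongrightarrow> 0) at_top"
        using \<alpha> unfolding \<sigma>_def
        by (intro filterlim_compose[OF exp_at_bot] filterlim_compose[OF filterlim_uminus_at_bot_at_top]
          filterlim_tendsto_pos_mult_at_top[OF tendsto_const] filterlim_ident) auto
      from tendsto_mult_right_zero[OF this, of "k * E x z 0"]
      have "((\<lambda>t. k * exp (- \<sigma> * t) * E x z 0) \<longlongrightarrow> 0) at_top" by (simp add: mult_ac)
      then show "((\<lambda>t. euclid_norm (estimate C P Q x z i t - x t)) \<longlongrightarrow> 0) at_top"
      proof (rule tendsto_sandwich[OF _ _ tendsto_const, rotated 2])
        show "\<forall>\<^sub>F t in at_top. 0 \<le> euclid_norm (estimate C P Q x z i t - x t)"
          unfolding euclid_norm_eq_sqrt using scalar_prod_self_nonneg by simp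
        show "\<forall>\<^sub>F t in at_top. euclid_norm (estimate C P Q x z i t - x t) \<le> k * exp (- \<sigma> * t) * E x z 0"
          using eventually_ge_at_top[of 0] by eventually_elim (use le E_decay[OF tr] in \<open>blast intro: order_trans\<close>)
      qed
    qed
    show "error_convergence_rate n N A C W r (\<lambda>i. n - p i) (2 * \<kappa> * K) Nm L S P Q \<alpha>"
      unfolding error_convergence_rate_def d_def[symmetric] E_def[symmetric]
    proof (intro exI[of _ k] conjI allI impI k)
      fix x z and t :: real assume tr: "?traj x z" and t: "0 \<le> t"
      have "k * exp (- \<sigma> * t) * E x z 0 \<le> k * exp (- \<alpha> * t) * E x z 0"
        unfolding \<sigma>_def using k E_nonneg t by (intro mult_right_mono mult_left_mono) (auto simp: algebra_simps)
      then show "E x z t \<le> k * exp (- \<alpha> * t) * E x z 0" using E_decay[OF tr t] by linarith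
    qed
  qed
qed

end
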